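(* Let $F$ be an infinitely divisible distribution on $[0,\infty)$ with Laplace transform $$\int_0^\infty e^{-\lambda x}F(dx)=\exp\Big(-a\lambda-\int_0^\infty(1-e^{-\lambda x})\,\nu(dx)\Big),\quad\lambda\ge0,$$ where $a\ge0$ and $\nu$ is a Borel measure on $(0,\infty)$ with $0<\mu:=\nu((1,\infty))<\infty$ and $\int_0^1x\,\nu(dx)<\infty$. Put $G(B)=\nu(B\cap(1,\infty))/\mu$. Let $0<T\le\infty$, $\Delta=(0,T]$, and if $T<\infty$ assume $G\in\mathcal L_\Delta$. Then $G\in\mathcal S_\Delta$ if and only if $\nu(x+\Delta)\sim F(x+\Delta)$ as $x\to\infty$.
   Context: For $0<T\le\infty$, $x+\Delta=(x,x+T]$. $G\in\mathcal L_\Delta$ means $G(x+\Delta)>0$ for all large $x$ and $G(x+t+\Delta)/G(x+\Delta)\to1$ as $x\to\infty$ uniformly in $t\in[0,1]$. A distribution $G$ on $[0,\infty)$ with unbounded support is in $\mathcal S_\Delta$ if $G\in\mathcal L_\Delta$ and $(G*G)(x+\Delta)\sim2G(x+\Delta)$. $a\sim b$ means $a/b\to1$. *)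

theory Defs
  imports "HOL-Probability.Probability" "HOL-Library.Landau_Symbols"
begin

definition shift_int :: "ereal \<Rightarrow> real \<Rightarrow> real set" where
  "shift_int T x = {y. x < y \<and> ereal y \<le> ereal x + T}"

definition L_Delta :: "ereal \<Rightarrow> real measure \<Rightarrow> bool" where
  "L_Delta T G \<longleftrightarrow>
     (\<forall>\<^sub>F x in at_top. measure G (shift_int T x) > 0) \<and>
     (\<forall>e>0. \<forall>\<^sub>F x in at_top. \<forall>t\<in>{0..1}.
         \<bar>measure G (shift_int T (x + t)) / measure G (shift_int T x) - 1\<bar> < e)"

definition S_Delta :: "ereal \<Rightarrow> real measure \<Rightarrow> bool" where
  "S_Delta T G \<longleftrightarrow>
     prob_space G \<and> sets G = sets borel \<and> emeasure G {..<0} = 0 \<and>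
     (\<forall>x. measure G {x<..} > 0) \<and>
     L_Delta T G \<and>
     (\<lambda>x. measure (convolution G G) (shift_int T x)) \<sim>[at_top] (\<lambda>x. 2 * measure G (shift_int T x))"

fun conv_pow :: "real measure \<Rightarrow> nat \<Rightarrow> real measure" where
  "conv_pow H 0 = return borel 0"
| "conv_pow H (Suc n) = convolution H (conv_pow H n)"

definition infinitely_divisible :: "real measure \<Rightarrow> bool" where
  "infinitely_divisible F \<longleftrightarrow>
     (\<forall>n\<ge>1. \<exists>H. prob_space H \<and> sets H = sets borel \<and> conv_pow H n = F)"

end

theory Submission
  imports Defs
begin

text \<open>
  Write \<open>g x = G (x + \<Delta>)\<close>. A weak limit of compound Poisson laws supplies the law \<open>B\<close> with
  Levy measure \<open>\<nu>\<close> restricted to \<open>(0, 1]\<close> and drift \<open>a\<close>; all its exponential moments are finite,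
  and uniqueness of Laplace transforms gives \<open>F = \<Sum>n. e\<^sup>-\<^sup>\<mu> \<mu>\<^sup>n / n! \<cdot> H\<^sub>n\<close> with
  \<open>H\<^sub>n = B * G\<^sup>*\<^sup>n\<close>. Always \<open>liminf H\<^sub>n (x + \<Delta>) / g x \<ge> n\<close>. If \<open>G\<close> is \<open>\<Delta>\<close>-subexponential, these ratios
  converge to \<open>n\<close> and are dominated by a geometric sequence, so the series may be summed termwise,
  with sum \<open>\<mu>\<close>. Conversely, if \<open>F (x + \<Delta>) / g x\<close> converges to \<open>\<mu> = \<Sum>n. e\<^sup>-\<^sup>\<mu> \<mu>\<^sup>n / n! \<cdot> n\<close>, then no term can
  exceed its lower bound in the limit. In particular \<open>H\<^sub>2 (x + \<Delta>) \<sim> 2 g x\<close>, which makes the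
  contribution of two large summands to \<open>H\<^sub>1 * G\<close>, and hence to \<open>G * G\<close>, negligible.
\<close>

subsection \<open>Convolutions of laws on the half-line\<close>

text \<open>For finite \<open>T\<close> the window probabilities of G need not be monotone, so
  adding a nonnegative summand may lower them, and G * G cannot be compared with H_2 directly. The
  converse therefore goes through the event that both summands are large: there the windows of H_1
  and G are evaluated only beyond a fixed threshold, where those of G are at most twice those of
  H_1, so negligibility passes from H_1 to G. For \<open>T = \<infinity>\<close> the direct
  comparison is immediate. The obstacle is then that long-tailedness is part of what has to be
  proved: until it has been extracted from an upper bound on G * G, only monotonicity of tails is
  available. Cutting the jumps at 1 serves three purposes. The jumps below have all exponential
  moments, so that their law is negligible against any long tail; the jumps above form a finite
  measure, so that their number is Poisson; and each of the latter exceeds 1, which makes the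
  support of F unbounded.\<close>

definition pos_law :: "real measure \<Rightarrow> bool" where
  "pos_law M \<longleftrightarrow> prob_space M \<and> sets M = sets borel \<and> (AE x in M. 0 \<le> x)"

lemma pos_lawD:
  assumes "pos_law M"
  shows "prob_space M" "sets M = sets borel" "AE x in M. 0 \<le> x" "space M = UNIV"
  using assms sets_eq_imp_space_eq[of M borel] by (auto simp: pos_law_def)

lemma pos_law_convolution:
  assumes A: "pos_law A" and B: "pos_law B"
  shows "pos_law (A \<star> B)"
proof -
  interpret A: prob_space A by (rule pos_lawD[OF A])
  interpret B: prob_space B by (rule pos_lawD[OF B])
  interpret pair_prob_space A B ..
  note [measurable_cong] = pos_lawD(2)[OF A] pos_lawD(2)[OF B]
  have "prob_space (A \<star> B)"
    unfolding convolution_def by (rule prob_space_distr) simp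
  moreover have "emeasure (A \<star> B) {..<0} = 0"
  proof -
    have "emeasure (A \<star> B) {..<0} = (\<integral>\<^sup>+x. \<integral>\<^sup>+y. indicator {..<0} (x + y) \<partial>B \<partial>A)"
      using pos_lawD(2)[OF A] pos_lawD(2)[OF B]
      by (intro convolution_emeasure') (auto intro: A.finite_measure_axioms B.finite_measure_axioms)
    also have "\<dots> = (\<integral>\<^sup>+x. 0 \<partial>A)"
    proof (rule nn_integral_cong_AE)
      show "AE x in A. (\<integral>\<^sup>+y. indicator {..<0} (x + y) \<partial>B) = 0"
        using pos_lawD(3)[OF A]
      proof eventually_elim
        case (elim x)
        have "(\<integral>\<^sup>+y. indicator {..<0} (x + y) \<partial>B) = (\<integral>\<^sup>+y. 0 \<partial>B)"
          by (rule nn_integral_cong_AE, use pos_lawD(3)[OF B] in eventually_elim)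
            (use elim in \<open>auto simp: indicator_def\<close>)
        then show ?case by simp
      qed
    qed
    finally show ?thesis by simp
  qed
  then have "AE x in A \<star> B. 0 \<le> x"
    by (intro AE_I[where N="{..<0}"]) auto
  ultimately show ?thesis by (simp add: pos_law_def)
qed

lemma pos_law_bounds_tendsto_1:
  assumes "pos_law M"
  shows "((\<lambda>h. measure M {..h}) \<longlongrightarrow> 1) at_top"
proof -
  interpret prob_space M by (rule pos_lawD[OF assms])
  interpret real_distribution M
    by unfold_locales (use pos_lawD[OF assms] in auto)
  show ?thesis using cdf_lim_at_top_prob by (simp add: cdf_def)
qed

section \<open>Window probabilities and the decomposition of a convolution\<close>

locale window =
  fixes T :: ereal
  assumes T_pos: "0 < T"
begin

abbreviation D :: "real measure \<Rightarrow> real \<Rightarrow> real" where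
  "D M x \<equiv> measure M (shift_int T x)"

lemma shift_int_cases: "(\<And>t. T = ereal t \<Longrightarrow> 0 < t \<Longrightarrow> P) \<Longrightarrow> (T = \<infinity> \<Longrightarrow> P) \<Longrightarrow> P"
  using T_pos by (cases T) auto

lemma shift_int_real: "shift_int (ereal t) x = {x<..x+t}"
  by (auto simp: shift_int_def)

lemma shift_int_PInf: "shift_int \<infinity> x = {x<..}"
  by (auto simp: shift_int_def)

lemma shift_int_sets [measurable]: "shift_int T x \<in> sets borel"
  by (rule shift_int_cases) (auto simp: shift_int_real shift_int_PInf)

lemma shift_int_translate: "y + z \<in> shift_int T x \<longleftrightarrow> y \<in> shift_int T (x - z)"
  by (rule shift_int_cases) (auto simp: shift_int_real shift_int_PInf)

lemma shift_int_gt: "y \<in> shift_int T x \<Longrightarrow> x < y"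
  by (simp add: shift_int_def)

text \<open>The sum is at most x + T and each coordinate exceeds its share of x, so neither can
  overshoot that share by more than T. This encloses the corner event in a product, to which
  independence applies.\<close>

lemma shift_int_corner:
  "y + z \<in> shift_int T x \<Longrightarrow> h < y \<Longrightarrow> x - h < z \<Longrightarrow> y \<in> shift_int T h \<and> z \<in> shift_int T (x - h)"
  by (rule shift_int_cases) (auto simp: shift_int_real shift_int_PInf)

text \<open>The constraint sits on the second summand: integrating over it leaves only the window
  mass of \<open>A\<close> at x - z, which is what asymptotic assumptions on \<open>A\<close>
  control.\<close>

definition slab :: "real measure \<Rightarrow> real measure \<Rightarrow> real set \<Rightarrow> real \<Rightarrow> real" where
  "slab A B W x = measure (A \<Otimes>\<^sub>M B) {p. snd p \<in> W \<and> fst p + snd p \<in> shift_int T x}"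

lemma pair_event_sets:
  assumes [measurable_cong]: "sets A = sets borel" "sets B = sets borel"
    and [measurable]: "V \<in> sets borel" "W \<in> sets borel"
  shows "{p. fst p \<in> V \<and> snd p \<in> W \<and> fst p + snd p \<in> shift_int T x} \<in> sets (A \<Otimes>\<^sub>M B)"
proof -
  have "space (A \<Otimes>\<^sub>M B) = UNIV"
    using sets_eq_imp_space_eq[OF assms(1)] sets_eq_imp_space_eq[OF assms(2)]
    by (auto simp: space_pair_measure)
  moreover have "{p \<in> space (A \<Otimes>\<^sub>M B). fst p \<in> V \<and> snd p \<in> W \<and> fst p + snd p \<in> shift_int T x}
      \<in> sets (A \<Otimes>\<^sub>M B)"
    by measurable
  ultimately show ?thesis by simp
qed

lemma D_convolution:
  assumes A: "pos_law A" and B: "pos_law B"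
  shows "D (A \<star> B) x = measure (A \<Otimes>\<^sub>M B) {p. fst p + snd p \<in> shift_int T x}"
proof -
  note [measurable_cong] = pos_lawD(2)[OF A] pos_lawD(2)[OF B]
  have "(\<lambda>(x, y). x + y) -` shift_int T x \<inter> space (A \<Otimes>\<^sub>M B) = {p. fst p + snd p \<in> shift_int T x}"
    using pos_lawD(4)[OF A] pos_lawD(4)[OF B] by (auto simp: space_pair_measure)
  then show ?thesis
    unfolding convolution_def by (subst measure_distr) auto
qed

lemma slab_nn_integral:
  assumes A: "pos_law A" and B: "pos_law B" and W: "W \<in> sets borel"
  shows "(\<lambda>z. emeasure A (shift_int T (x - z)) * indicator W z) \<in> borel_measurable B"
    and "ennreal (slab A B W x) = (\<integral>\<^sup>+z. emeasure A (shift_int T (x - z)) * indicator W z \<partial>B)"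
proof -
  interpret A: prob_space A by (rule pos_lawD[OF A])
  interpret B: prob_space B by (rule pos_lawD[OF B])
  interpret pair_prob_space A B ..
  note [measurable_cong] = pos_lawD(2)[OF A] pos_lawD(2)[OF B]
  let ?S = "{p. snd p \<in> W \<and> fst p + snd p \<in> shift_int T x}"
  have S: "?S \<in> sets (A \<Otimes>\<^sub>M B)"
    using pair_event_sets[OF pos_lawD(2)[OF A] pos_lawD(2)[OF B] _ W, of UNIV x] by simp
  have sec: "emeasure A ((\<lambda>y. (y, z)) -` ?S) = emeasure A (shift_int T (x - z)) * indicator W z" for z
    by (auto simp: shift_int_translate vimage_def split: split_indicator)
  show "(\<lambda>z. emeasure A (shift_int T (x - z)) * indicator W z) \<in> borel_measurable B"
    using measurable_emeasure_Pair2[OF S] unfolding sec .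
  show "ennreal (slab A B W x) = (\<integral>\<^sup>+z. emeasure A (shift_int T (x - z)) * indicator W z \<partial>B)"
    unfolding slab_def emeasure_eq_measure[symmetric]
    by (subst emeasure_pair_measure_alt2[OF S]) (simp only: sec)
qed

text \<open>As \<open>B\<close> lives on the half-line, the bound is required for nonnegative z
  only, so that \<open>W = {..h}\<close> stands for the compact interval [0,h].\<close>

lemma slab_le:
  assumes A: "pos_law A" and B: "pos_law B" and W: "W \<in> sets borel" and K: "0 \<le> K"
    and le: "\<And>z. z \<in> W \<Longrightarrow> 0 \<le> z \<Longrightarrow> D A (x - z) \<le> K"
  shows "slab A B W x \<le> K * measure B W"
proof -
  interpret A: prob_space A by (rule pos_lawD[OF A])
  interpret B: prob_space B by (rule pos_lawD[OF B])
  have "ennreal (slab A B W x) \<le> (\<integral>\<^sup>+z. ennreal K * indicator W z \<partial>B)"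
    unfolding slab_nn_integral(2)[OF A B W]
    by (rule nn_integral_mono_AE, use pos_lawD(3)[OF B] in eventually_elim)
      (auto simp: A.emeasure_eq_measure le split: split_indicator intro!: ennreal_leI)
  also have "\<dots> = ennreal (K * measure B W)"
    using K W pos_lawD(2)[OF B] by (subst nn_integral_cmult_indicator) (auto simp: B.emeasure_eq_measure ennreal_mult)
  finally show ?thesis using K by (simp add: ennreal_le_iff)
qed

lemma slab_ge:
  assumes A: "pos_law A" and B: "pos_law B" and W: "W \<in> sets borel" and K: "0 \<le> K"
    and le: "\<And>z. z \<in> W \<Longrightarrow> 0 \<le> z \<Longrightarrow> K \<le> D A (x - z)"
  shows "K * measure B W \<le> slab A B W x"
proof -
  interpret A: prob_space A by (rule pos_lawD[OF A])
  interpret B: prob_space B by (rule pos_lawD[OF B])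
  have "ennreal (K * measure B W) = (\<integral>\<^sup>+z. ennreal K * indicator W z \<partial>B)"
    using K W pos_lawD(2)[OF B] by (subst nn_integral_cmult_indicator) (auto simp: B.emeasure_eq_measure ennreal_mult)
  also have "\<dots> \<le> ennreal (slab A B W x)"
    unfolding slab_nn_integral(2)[OF A B W]
    by (rule nn_integral_mono_AE, use pos_lawD(3)[OF B] in eventually_elim)
      (auto simp: A.emeasure_eq_measure le split: split_indicator intro!: ennreal_leI)
  finally show ?thesis by (subst (asm) ennreal_le_iff) (simp_all add: slab_def)
qed

text \<open>An inequality between window masses at the points x - z integrates against the common
  second law. On the middle slab these points are at least h, so bounds that hold only far out can
  be used.\<close>

lemma slab_mono:
  assumes A: "pos_law A" and A': "pos_law A'" and B: "pos_law B" and W: "W \<in> sets borel" and K: "0 \<le> K"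
    and le: "\<And>z. z \<in> W \<Longrightarrow> 0 \<le> z \<Longrightarrow> D A (x - z) \<le> K * D A' (x - z)"
  shows "slab A B W x \<le> K * slab A' B W x"
proof -
  interpret A: prob_space A by (rule pos_lawD[OF A])
  interpret A': prob_space A' by (rule pos_lawD[OF A'])
  have "ennreal (slab A B W x) \<le> (\<integral>\<^sup>+z. ennreal K * (emeasure A' (shift_int T (x - z)) * indicator W z) \<partial>B)"
    unfolding slab_nn_integral(2)[OF A B W]
    by (rule nn_integral_mono_AE, use pos_lawD(3)[OF B] in eventually_elim)
      (use K in \<open>auto simp: A.emeasure_eq_measure A'.emeasure_eq_measure le ennreal_mult[symmetric]
        split: split_indicator intro!: ennreal_leI\<close>)
  also have "\<dots> = ennreal (K * slab A' B W x)"
    using K slab_nn_integral[OF A' B W]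
    by (subst nn_integral_cmult) (auto simp: ennreal_mult slab_def)
  finally show ?thesis using K by (subst (asm) ennreal_le_iff) (simp_all add: slab_def)
qed

lemma slab_swap:
  assumes A: "pos_law A" and B: "pos_law B" and W: "W \<in> sets borel"
  shows "measure (A \<Otimes>\<^sub>M B) {p. fst p \<in> W \<and> fst p + snd p \<in> shift_int T x} = slab B A W x"
proof -
  interpret A: prob_space A by (rule pos_lawD[OF A])
  interpret B: prob_space B by (rule pos_lawD[OF B])
  interpret pair_prob_space A B ..
  note [measurable_cong] = pos_lawD(2)[OF A] pos_lawD(2)[OF B]
  let ?S = "{p. fst p \<in> W \<and> fst p + snd p \<in> shift_int T x}"
  have S: "?S \<in> sets (A \<Otimes>\<^sub>M B)"
    using pair_event_sets[OF pos_lawD(2)[OF A] pos_lawD(2)[OF B] W, of UNIV x] by simp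
  have "(\<lambda>(x, y). (y, x)) -` ?S \<inter> space (B \<Otimes>\<^sub>M A) =
      {p. snd p \<in> W \<and> fst p + snd p \<in> shift_int T x}"
    using pos_lawD(4)[OF A] pos_lawD(4)[OF B] by (auto simp: space_pair_measure add.commute)
  then show ?thesis
    by (subst distr_pair_swap, subst measure_distr) (use S in \<open>auto simp: slab_def\<close>)
qed

abbreviation mid :: "real measure \<Rightarrow> real measure \<Rightarrow> real \<Rightarrow> real \<Rightarrow> real" where
  "mid A B h x \<equiv> slab A B {h<..x-h} x"

text \<open>With \<open>Y\<close> and \<open>Z\<close> independent of laws \<open>A\<close> and \<open>B\<close>, the event \<open>Y + Z \<in> x + \<Delta>\<close>
  splits into \<open>Z \<le> h\<close>, \<open>Y \<le> h\<close>, \<open>h < Z \<le> x - h\<close>, and the corner \<open>Y > h, Z > x - h\<close>.\<close>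

lemma convolution_split:
  assumes A: "pos_law A" and B: "pos_law B" and h: "2 * h \<le> x"
  shows "slab A B {..h} x + slab B A {..h} x + mid A B h x \<le> D (A \<star> B) x"
    and "D (A \<star> B) x \<le> slab A B {..h} x + slab B A {..h} x + mid A B h x + D A h * D B (x - h)"
proof -
  interpret A: prob_space A by (rule pos_lawD[OF A])
  interpret B: prob_space B by (rule pos_lawD[OF B])
  interpret pair_prob_space A B ..
  note [measurable_cong] = pos_lawD(2)[OF A] pos_lawD(2)[OF B]
  note ev = pair_event_sets[OF pos_lawD(2)[OF A] pos_lawD(2)[OF B]]
  let ?S = "\<lambda>V W. {p. fst p \<in> V \<and> snd p \<in> W \<and> fst p + snd p \<in> shift_int T x}"
  have S: "?S V W \<in> sets (A \<Otimes>\<^sub>M B)" if "V \<in> sets borel" "W \<in> sets borel" for V W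
    using ev that by blast
  let ?S1 = "?S UNIV {..h}" and ?S2 = "?S {..h} UNIV" and ?S3 = "?S UNIV {h<..x-h}"
    and ?S4 = "?S {h<..} {x-h<..}"
  have m1: "slab A B {..h} x = prob ?S1" and m3: "mid A B h x = prob ?S3"
    by (simp_all add: slab_def)
  have m2: "slab B A {..h} x = prob ?S2"
    using slab_swap[OF A B, of "{..h}" x] by simp
  have D: "D (A \<star> B) x = prob (?S UNIV UNIV)"
    using D_convolution[OF A B] by simp
  \<comment> \<open>Disjointness uses that the sum exceeds x: two summands of size at most h give at
    most 2h \<le> x, and Y \<le> h with Z \<le> x - h gives at most x.\<close>
  have "prob (?S1 \<union> ?S2 \<union> ?S3) = prob ?S1 + prob ?S2 + prob ?S3"
    using h by (subst finite_measure_Union S; (intro sets.Un S)?; (subst finite_measure_Union)?; (intro S)?)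
      (auto dest!: shift_int_gt)
  moreover have "prob (?S1 \<union> ?S2 \<union> ?S3) \<le> prob (?S UNIV UNIV)"
    by (intro finite_measure_mono S) auto
  ultimately show "slab A B {..h} x + slab B A {..h} x + mid A B h x \<le> D (A \<star> B) x"
    unfolding m1 m2 m3 D by simp
  have "?S UNIV UNIV \<subseteq> ?S1 \<union> ?S2 \<union> ?S3 \<union> ?S4" by auto
  then have "prob (?S UNIV UNIV) \<le> prob (?S1 \<union> ?S2 \<union> ?S3 \<union> ?S4)"
    by (intro finite_measure_mono sets.Un S) auto
  also have "\<dots> \<le> prob (?S1 \<union> ?S2 \<union> ?S3) + prob ?S4"
    by (intro measure_Un_le sets.Un S) auto
  also have "prob ?S4 \<le> prob (shift_int T h \<times> shift_int T (x - h))"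
    using shift_int_corner pos_lawD(2)[OF A] pos_lawD(2)[OF B]
    by (intro finite_measure_mono pair_measureI) auto
  also have "\<dots> = D A h * D B (x - h)"
    using pos_lawD(2)[OF A] pos_lawD(2)[OF B]
    by (simp add: measure_def B.emeasure_pair_measure_Times enn2real_mult)
  finally show "D (A \<star> B) x \<le> slab A B {..h} x + slab B A {..h} x + mid A B h x + D A h * D B (x - h)"
    unfolding m1 m2 m3 D using \<open>prob (?S1 \<union> ?S2 \<union> ?S3) = _\<close> by linarith
qed

end
subsection \<open>Long-tailed laws\<close>

context window
begin

text \<open>This and \<open>majorizes\<close> are liminf \<ge> c and limsup \<le> c of the ratio,
  freed of division. The slack is multiplicative here, since the losses in the lower bounds
  multiply; it is additive in \<open>majorizes\<close>, where c = 0 has to express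
  negligibility.\<close>

definition minorizes :: "real measure \<Rightarrow> real measure \<Rightarrow> real \<Rightarrow> bool" where
  "minorizes G H c \<longleftrightarrow> (\<forall>\<theta>. 0 < \<theta> \<longrightarrow> \<theta> < 1 \<longrightarrow> (\<forall>\<^sub>F x in at_top. \<theta> * c * D G x \<le> D H x))"

definition majorizes :: "real measure \<Rightarrow> real measure \<Rightarrow> real \<Rightarrow> bool" where
  "majorizes G H c \<longleftrightarrow> (\<forall>e>0. \<forall>\<^sub>F x in at_top. D H x \<le> (c + e) * D G x)"

text \<open>The principle of a single big jump as an iterated limit, first in x and then in h: two
  summands that both exceed h contribute nothing of the order of \<open>D G\<close>.\<close>

definition mid_negligible :: "real measure \<Rightarrow> real measure \<Rightarrow> bool" where
  "mid_negligible H G \<longleftrightarrow>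
     (\<forall>\<delta>>0. \<forall>\<^sub>F h in at_top. \<forall>\<^sub>F x in at_top. mid H G h x \<le> \<delta> * D G x)"

lemma tendsto_ratio_iff:
  assumes "\<forall>\<^sub>F x in at_top. 0 < D G x" "0 \<le> c"
  shows "((\<lambda>x. D H x / D G x) \<longlongrightarrow> c) at_top \<longleftrightarrow> minorizes G H c \<and> majorizes G H c"
proof
  assume lim: "((\<lambda>x. D H x / D G x) \<longlongrightarrow> c) at_top"
  show "minorizes G H c \<and> majorizes G H c"
    unfolding minorizes_def majorizes_def
  proof (intro conjI allI impI)
    fix e :: real assume "0 < e"
    then have "\<forall>\<^sub>F x in at_top. D H x / D G x < c + e"
      by (intro order_tendstoD(2)[OF lim]) simp
    then show "\<forall>\<^sub>F x in at_top. D H x \<le> (c + e) * D G x"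
      using assms(1) by eventually_elim (simp add: field_simps)
  next
    fix \<theta> :: real assume \<theta>: "0 < \<theta>" "\<theta> < 1"
    show "\<forall>\<^sub>F x in at_top. \<theta> * c * D G x \<le> D H x"
    proof (cases "c = 0")
      case False
      with \<theta> assms have "\<theta> * c < c" by simp
      then have "\<forall>\<^sub>F x in at_top. \<theta> * c < D H x / D G x"
        by (rule order_tendstoD(1)[OF lim])
      then show ?thesis
        using assms(1) by eventually_elim (simp add: field_simps)
    qed simp
  qed
next
  assume *: "minorizes G H c \<and> majorizes G H c"
  show "((\<lambda>x. D H x / D G x) \<longlongrightarrow> c) at_top"
  proof (rule order_tendstoI)
    fix a assume "c < a"
    then have "\<forall>\<^sub>F x in at_top. D H x \<le> (c + (a - c) / 2) * D G x"
      using * by (auto simp: majorizes_def)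
    then show "\<forall>\<^sub>F x in at_top. D H x / D G x < a"
      using assms(1)
    proof eventually_elim
      case (elim x)
      have "(c + (a - c) / 2) * D G x < a * D G x"
        using \<open>c < a\<close> elim(2) by (intro mult_strict_right_mono) (auto simp: field_simps)
      with elim have "D H x < a * D G x" by linarith
      with elim(2) show ?case by (simp add: pos_divide_less_eq)
    qed
  next
    fix a assume a: "a < c"
    show "\<forall>\<^sub>F x in at_top. a < D H x / D G x"
    proof (cases "a < 0")
      case True
      then show ?thesis
        by (intro always_eventually allI order.strict_trans2[OF True]) simp
    next
      case False
      define \<theta> where "\<theta> = (a / c + 1) / 2"
      have \<theta>: "0 < \<theta>" "\<theta> < 1" "a < \<theta> * c"
        using a False by (auto simp: \<theta>_def field_simps)
      then have "\<forall>\<^sub>F x in at_top. \<theta> * c * D G x \<le> D H x"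
        using * by (auto simp: minorizes_def)
      then show ?thesis
        using assms(1)
      proof eventually_elim
        case (elim x)
        have "a * D G x < \<theta> * c * D G x"
          using \<theta> elim(2) by (intro mult_strict_right_mono) auto
        with elim(1) have "a * D G x < D H x" by linarith
        with elim(2) show ?case by (simp add: pos_less_divide_eq)
      qed
    qed
  qed
qed

lemma minorizes_0: "minorizes G H 0"
  by (simp add: minorizes_def)

lemma minorizes_refl: "minorizes G G 1"
  by (auto simp: minorizes_def intro!: always_eventually mult_left_le_one_le)

lemma majorizes_refl: "majorizes G G 1"
  by (auto simp: majorizes_def algebra_simps intro!: always_eventually)

lemma eventually_prefix_mass:
  assumes "pos_law M" "\<theta> < 1"
  shows "\<forall>\<^sub>F h in at_top. 0 \<le> h \<and> \<theta> \<le> measure M {..h}"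
  using order_tendstoD(1)[OF pos_law_bounds_tendsto_1[OF assms(1)] assms(2)] eventually_ge_at_top[of 0]
  by eventually_elim simp

lemma D_le_tail:
  assumes "pos_law M"
  shows "D M h \<le> 1 - measure M {..h}"
proof -
  interpret prob_space M by (rule pos_lawD[OF assms])
  have "D M h \<le> measure M (space M - {..h})"
    using pos_lawD[OF assms] by (intro finite_measure_mono) (auto dest: shift_int_gt)
  also have "\<dots> = 1 - measure M {..h}"
    using pos_lawD(2)[OF assms] by (intro prob_compl) auto
  finally show ?thesis .
qed

end

section \<open>Consequences of long-tailedness for one convolution\<close>

locale long_tailed_law = window T for T +
  fixes G :: "real measure"
  assumes law: "pos_law G" and L: "L_Delta T G"
begin

lemma D_pos: "\<forall>\<^sub>F x in at_top. 0 < D G x"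
  using L by (simp add: L_Delta_def)

lemma ratio_unit:
  assumes "1 < q"
  shows "\<forall>\<^sub>F x in at_top. \<forall>t\<in>{0..1}. D G (x + t) \<le> q * D G x \<and> D G x \<le> q * D G (x + t)"
proof -
  \<comment> \<open>The tolerance around 1 is symmetric, so it must be the smaller of the gaps from
    1 to 1/q and to q.\<close>
  have e: "0 < 1 - 1 / q" "1 - 1 / q \<le> q - 1"
    using assms by (auto simp: field_simps) (sos)
  then have "\<forall>\<^sub>F x in at_top. \<forall>t\<in>{0..1}. \<bar>D G (x + t) / D G x - 1\<bar> < 1 - 1 / q"
    using L unfolding L_Delta_def by blast
  then show ?thesis
    using D_pos
  proof eventually_elim
    case (elim x)
    show ?case
    proof
      fix t :: real assume "t \<in> {0..1}"
      then have *: "D G (x + t) / D G x < q" "1 / q < D G (x + t) / D G x"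
        using elim(1) e(2) by (smt (verit))+
      then show "D G (x + t) \<le> q * D G x \<and> D G x \<le> q * D G (x + t)"
        using elim(2) assms by (simp add: field_simps)
    qed
  qed
qed

text \<open>Unit steps compose. The accuracy \<open>q\<close> varies in the induction because it is
  split as sqrt q for the first n units times sqrt q for the last one.\<close>

lemma ratio_nat:
  assumes "1 < q"
  shows "\<forall>\<^sub>F x in at_top. \<forall>t\<in>{0..real n}. D G (x + t) \<le> q * D G x \<and> D G x \<le> q * D G (x + t)"
  using assms
proof (induction n arbitrary: q)
  case 0
  then show ?case by (intro always_eventually) (auto intro: mult_right_mono[of 1 q "D G _", simplified])
next
  case (Suc n)
  define r where "r = sqrt q"
  have r: "1 < r" "q = r * r" using Suc.prems by (auto simp: r_def)
  have "\<forall>\<^sub>F x in at_top. \<forall>t\<in>{0..1}. D G (x + real n + t) \<le> r * D G (x + real n) \<and> D G (x + real n) \<le> r * D G (x + real n + t)"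
    using ratio_unit[OF r(1)] unfolding eventually_at_top_linorder
    by (metis add_increasing2 of_nat_0_le_iff)
  then show ?case
    using Suc.IH[OF r(1)]
  proof eventually_elim
    case (elim x)
    show ?case
    proof
      fix t assume t: "t \<in> {0..real (Suc n)}"
      show "D G (x + t) \<le> q * D G x \<and> D G x \<le> q * D G (x + t)"
      proof (cases "t \<le> real n")
        case True
        then have "D G (x + t) \<le> r * D G x" "D G x \<le> r * D G (x + t)"
          using elim(2) t by auto
        moreover have "r * D G y \<le> q * D G y" for y
          using r by (intro mult_right_mono) auto
        ultimately show ?thesis by (meson order_trans)
      next
        case False
        then have "t - real n \<in> {0..1}" using t by auto
        from elim(1)[rule_format, OF this]
        have 1: "D G (x + t) \<le> r * D G (x + real n)" "D G (x + real n) \<le> r * D G (x + t)"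
          by simp_all
        have 2: "D G (x + real n) \<le> r * D G x" "D G x \<le> r * D G (x + real n)"
          using elim(2) by auto
        have "r * D G (x + real n) \<le> r * (r * D G x)" "r * D G (x + real n) \<le> r * (r * D G (x + t))"
          using 1 2 r by (auto intro!: mult_left_mono)
        with 1 2 show ?thesis by (simp add: r(2) mult.assoc)
      qed
    qed
  qed
qed

lemma ratio_back:
  assumes "1 < q"
  shows "\<forall>\<^sub>F x in at_top. \<forall>y\<in>{0..h}. D G (x - y) \<le> q * D G x \<and> D G x \<le> q * D G (x - y)"
proof -
  obtain n where n: "h \<le> real n" using real_arch_simple by blast
  obtain x0 where x0: "\<And>x t. x0 \<le> x \<Longrightarrow> t \<in> {0..real n} \<Longrightarrow> D G (x + t) \<le> q * D G x \<and> D G x \<le> q * D G (x + t)"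
    using ratio_nat[OF assms, of n] unfolding eventually_at_top_linorder by blast
  show ?thesis
    unfolding eventually_at_top_linorder
  proof (intro exI[of _ "x0 + h"] allI impI ballI)
    fix x y assume "x0 + h \<le> x" "y \<in> {0..h}"
    then show "D G (x - y) \<le> q * D G x \<and> D G x \<le> q * D G (x - y)"
      using x0[of "x - y" y] n by auto
  qed
qed

text \<open>One factor \<theta> is lost in each of three places: passing from \<open>A\<close> to
  \<open>G\<close>, shifting the window by z \<le> h, and cutting \<open>B\<close> off at h.\<close>

lemma slab_lower:
  assumes A: "pos_law A" and B: "pos_law B" and c: "0 \<le> c" and min: "minorizes G A c"
    and \<theta>: "0 < \<theta>" "\<theta> < 1" and h: "\<theta> \<le> measure B {..h}"
  shows "\<forall>\<^sub>F x in at_top. \<theta> ^ 3 * c * D G x \<le> slab A B {..h} x"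
proof -
  obtain x0 where x0: "\<And>x. x0 \<le> x \<Longrightarrow> \<theta> * c * D G x \<le> D A x"
    using min \<theta> unfolding minorizes_def eventually_at_top_linorder by blast
  have "1 < 1 / \<theta>" using \<theta> by simp
  from ratio_back[OF this, of h] show ?thesis
    using eventually_ge_at_top[of "x0 + h"]
  proof eventually_elim
    case (elim x)
    have "\<theta> * (\<theta> * c) * D G x \<le> D A (x - z)" if "z \<in> {..h}" "0 \<le> z" for z
    proof -
      have "D G x \<le> 1 / \<theta> * D G (x - z)" using elim(1) that by auto
      then have "\<theta> * D G x \<le> D G (x - z)" using \<theta> by (simp add: field_simps)
      then have "\<theta> * c * (\<theta> * D G x) \<le> \<theta> * c * D G (x - z)"
        using \<theta> c by (intro mult_left_mono) auto
      also have "\<dots> \<le> D A (x - z)" using elim(2) that by (intro x0) auto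
      finally show ?thesis by (simp add: mult_ac)
    qed
    then have "\<theta> * (\<theta> * c) * D G x * measure B {..h} \<le> slab A B {..h} x"
      using \<theta> c by (intro slab_ge[OF A B]) auto
    moreover have "\<theta> * (\<theta> * c) * D G x * \<theta> \<le> \<theta> * (\<theta> * c) * D G x * measure B {..h}"
      using \<theta> c h by (intro mult_left_mono) auto
    ultimately show ?case by (simp add: power3_eq_cube mult_ac)
  qed
qed

lemma slab_upper:
  assumes A: "pos_law A" and B: "pos_law B" and c: "0 \<le> c" and maj: "majorizes G A c"
    and e: "0 < e" and q: "1 < q"
  shows "\<forall>\<^sub>F x in at_top. slab A B {..h} x \<le> (c + e) * q * D G x"
proof -
  obtain x0 where x0: "\<And>x. x0 \<le> x \<Longrightarrow> D A x \<le> (c + e) * D G x"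
    using maj e unfolding majorizes_def eventually_at_top_linorder by blast
  interpret B: prob_space B by (rule pos_lawD[OF B])
  from ratio_back[OF q, of h] show ?thesis
    using eventually_ge_at_top[of "x0 + h"]
  proof eventually_elim
    case (elim x)
    have "D A (x - z) \<le> (c + e) * q * D G x" if "z \<in> {..h}" "0 \<le> z" for z
    proof -
      have "D A (x - z) \<le> (c + e) * D G (x - z)" using elim(2) that by (intro x0) auto
      also have "\<dots> \<le> (c + e) * (q * D G x)" using elim(1) that c e by (intro mult_left_mono) auto
      finally show ?thesis by (simp add: mult_ac)
    qed
    then have "slab A B {..h} x \<le> (c + e) * q * D G x * measure B {..h}"
      using c e q by (intro slab_le[OF A B]) auto
    also have "\<dots> \<le> (c + e) * q * D G x" using c e q by (intro mult_right_le_one_le) auto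
    finally show ?case .
  qed
qed

text \<open>One large summand suffices. The disjoint events Z \<le> h and Y \<le> h contribute about
  c and 1 respectively, and the middle slab is dropped. The cube root compensates for the three
  losses in \<open>slab_lower\<close>.\<close>

lemma minorizes_convolution:
  assumes A: "pos_law A" and c: "0 \<le> c" and min: "minorizes G A c"
  shows "minorizes G (A \<star> G) (c + 1)"
  unfolding minorizes_def
proof (intro allI impI)
  fix \<theta> :: real assume \<theta>: "0 < \<theta>" "\<theta> < 1"
  define \<eta> where "\<eta> = root 3 \<theta>"
  have \<eta>: "0 < \<eta>" "\<eta> < 1" "\<eta> ^ 3 = \<theta>" using \<theta> by (auto simp: \<eta>_def)
  have "\<forall>\<^sub>F h in at_top. (0 \<le> h \<and> \<eta> \<le> measure G {..h}) \<and> (0 \<le> h \<and> \<eta> \<le> measure A {..h})"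
    using law A \<eta> by (intro eventually_conj eventually_prefix_mass)
  from eventually_happens[OF this] obtain h where h: "0 \<le> h" "\<eta> \<le> measure G {..h}" "\<eta> \<le> measure A {..h}"
    by auto
  from slab_lower[OF A law c min \<eta>(1,2) h(2)] slab_lower[OF law A zero_le_one minorizes_refl \<eta>(1,2) h(3)]
    eventually_ge_at_top[of "2 * h"]
  show "\<forall>\<^sub>F x in at_top. \<theta> * (c + 1) * D G x \<le> D (A \<star> G) x"
  proof eventually_elim
    case (elim x)
    have "0 \<le> mid A G h x" by (simp add: slab_def)
    with elim convolution_split(1)[OF A law elim(3)] show ?case
      by (simp add: \<eta>(3) algebra_simps)
  qed
qed

text \<open>The two slabs with one bounded summand already use up nearly c + 1, which is all that
  the upper bound on the convolution allows, so nothing is left for the middle.\<close>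

lemma mid_negligibleI:
  assumes A: "pos_law A" and c: "0 \<le> c" and min: "minorizes G A c" and maj: "majorizes G (A \<star> G) (c + 1)"
  shows "mid_negligible A G"
  unfolding mid_negligible_def
proof (intro allI impI)
  fix \<delta> :: real assume \<delta>: "0 < \<delta>"
  \<comment> \<open>Half of \<delta> pays for the slack in the upper bound, the other half for (c +
    1)(1 - \<theta>); the maximum with 1/2 only keeps \<theta> positive.\<close>
  define \<theta> where "\<theta> = max (1/2) (1 - \<delta> / (2 * (c + 1)))"
  have \<theta>: "0 < \<theta>" "\<theta> < 1" using \<delta> c by (auto simp: \<theta>_def)
  have "1 - \<theta> \<le> \<delta> / (2 * (c + 1))" by (simp add: \<theta>_def)
  then have \<theta>c: "(c + 1) * (1 - \<theta>) \<le> \<delta> / 2"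
    using c by (subst (asm) pos_le_divide_eq) (auto simp: algebra_simps)
  define \<eta> where "\<eta> = root 3 \<theta>"
  have \<eta>: "0 < \<eta>" "\<eta> < 1" "\<eta> ^ 3 = \<theta>" using \<theta> by (auto simp: \<eta>_def)
  have "\<forall>\<^sub>F h in at_top. (0 \<le> h \<and> \<eta> \<le> measure G {..h}) \<and> (0 \<le> h \<and> \<eta> \<le> measure A {..h})"
    using law A \<eta> by (intro eventually_conj eventually_prefix_mass)
  then show "\<forall>\<^sub>F h in at_top. \<forall>\<^sub>F x in at_top. mid A G h x \<le> \<delta> * D G x"
  proof eventually_elim
    case (elim h)
    have "\<forall>\<^sub>F x in at_top. D (A \<star> G) x \<le> (c + 1 + \<delta> / 2) * D G x"
      using maj \<delta> unfolding majorizes_def by simp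
    with slab_lower[OF A law c min \<eta>(1,2), of h] slab_lower[OF law A zero_le_one minorizes_refl \<eta>(1,2), of h]
      eventually_ge_at_top[of "2 * h"] elim
    have "\<forall>\<^sub>F x in at_top. D (A \<star> G) x \<le> (c + 1 + \<delta> / 2) * D G x \<and> \<theta> * c * D G x \<le> slab A G {..h} x \<and>
        \<theta> * 1 * D G x \<le> slab G A {..h} x \<and> 2 * h \<le> x"
      by (auto intro!: eventually_conj simp: \<eta>(3))
    then show ?case
    proof eventually_elim
      case (elim x)
      have "mid A G h x \<le> (c + 1 + \<delta> / 2) * D G x - \<theta> * c * D G x - \<theta> * D G x"
        using elim convolution_split(1)[OF A law, of h x] by simp
      also have "\<dots> = ((c + 1) * (1 - \<theta>) + \<delta> / 2) * D G x" by (simp add: algebra_simps)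
      also have "\<dots> \<le> \<delta> * D G x" using \<theta>c by (intro mult_right_mono) auto
      finally show ?case .
    qed
  qed
qed

text \<open>For z \<le> x - h the point x - z is at least h, where \<open>A\<close> is bounded by c
  + 1 times \<open>G\<close>; the middle slab of \<open>A\<close> thus inherits smallness from that
  of \<open>G\<close>. The corner is small because \<open>D A h\<close> is at most a tail of
  \<open>A\<close>.\<close>

lemma majorizes_convolution:
  assumes A: "pos_law A" and c: "0 \<le> c" and maj: "majorizes G A c" and mid: "mid_negligible G G"
  shows "majorizes G (A \<star> G) (c + 1)"
  unfolding majorizes_def
proof (intro allI impI)
  fix e :: real assume e: "0 < e"
  \<comment> \<open>The four pieces add up to c + 1 + \<delta>(2c + 4 + 2\<delta>), and \<delta>
    \<le> 1 turns the error into at most \<delta>(2c + 6).\<close>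
  define \<delta> where "\<delta> = min 1 (e / (2 * c + 6))"
  have \<delta>01: "0 < \<delta>" "\<delta> \<le> 1" and "\<delta> \<le> e / (2 * c + 6)" using e c by (auto simp: \<delta>_def)
  then have "(2 * c + 6) * \<delta> \<le> e" using c by (simp add: pos_le_divide_eq mult.commute)
  note \<delta> = \<delta>01 this
  have q: "1 < 1 + \<delta>" using \<delta> by simp
  obtain x0 where x0: "\<And>x. x0 \<le> x \<Longrightarrow> D A x \<le> (c + 1) * D G x"
    using maj unfolding majorizes_def eventually_at_top_linorder by (meson zero_less_one)
  have "1 - \<delta> < 1" using \<delta> by simp
  with mid \<delta> have "\<forall>\<^sub>F h in at_top. (\<forall>\<^sub>F x in at_top. mid G G h x \<le> \<delta> * D G x) \<and>
      (0 \<le> h \<and> 1 - \<delta> \<le> measure A {..h}) \<and> x0 \<le> h"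
    unfolding mid_negligible_def
    by (intro eventually_conj eventually_prefix_mass A eventually_ge_at_top) auto
  from eventually_happens[OF this] obtain h where h: "\<forall>\<^sub>F x in at_top. mid G G h x \<le> \<delta> * D G x"
    "0 \<le> h" "1 - \<delta> \<le> measure A {..h}" "x0 \<le> h" by auto
  have Dh: "D A h \<le> \<delta>" using D_le_tail[OF A, of h] h by simp
  interpret A: prob_space A by (rule pos_lawD[OF A])
  have "\<forall>\<^sub>F x in at_top. slab G A {..h} x \<le> (1 + \<delta>) * D G x"
    using ratio_back[OF q, of h]
  proof eventually_elim
    case (elim x)
    have "slab G A {..h} x \<le> (1 + \<delta>) * D G x * measure A {..h}"
      using elim \<delta> by (intro slab_le[OF law A]) auto
    also have "\<dots> \<le> (1 + \<delta>) * D G x" using \<delta> by (intro mult_right_le_one_le) auto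
    finally show ?case .
  qed
  with h(1) slab_upper[OF A law c maj \<delta>(1) q, of h] ratio_back[OF q, of h] eventually_ge_at_top[of "2 * h"]
  show "\<forall>\<^sub>F x in at_top. D (A \<star> G) x \<le> (c + 1 + e) * D G x"
  proof eventually_elim
    case (elim x)
    have m: "mid A G h x \<le> (c + 1) * mid G G h x"
      using c h by (intro slab_mono[OF A law law]) (auto intro!: x0)
    have "(c + 1) * mid G G h x \<le> (c + 1) * (\<delta> * D G x)"
      using elim(1) c by (intro mult_left_mono) auto
    moreover have "D A h * D G (x - h) \<le> \<delta> * ((1 + \<delta>) * D G x)"
      using elim(3) h Dh \<delta> by (intro mult_mono) auto
    ultimately have "D (A \<star> G) x \<le> ((c + \<delta>) * (1 + \<delta>) + (1 + \<delta>) + (c + 1) * \<delta> + \<delta> * (1 + \<delta>)) * D G x"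
      using convolution_split(2)[OF A law elim(4)] elim m by (simp add: algebra_simps)
    also have "\<dots> = (c + 1 + \<delta> * (2 * c + 4 + 2 * \<delta>)) * D G x" by (simp add: algebra_simps)
    also have "\<dots> \<le> (c + 1 + e) * D G x"
    proof (intro mult_right_mono)
      have "\<delta> * (2 * c + 4 + 2 * \<delta>) \<le> \<delta> * (2 * c + 6)" using \<delta> by (intro mult_left_mono) auto
      with \<delta>(3) show "c + 1 + \<delta> * (2 * c + 4 + 2 * \<delta>) \<le> c + 1 + e" by (simp add: mult.commute)
    qed simp
    finally show ?case .
  qed
qed

text \<open>A liminf of at least 1 gives \<open>D G\<close> \<le> 2 \<open>D A\<close> beyond some
  point, and the middle slab looks only beyond h. This is how the factor \<open>B\<close> is removed
  from H_1 when window masses are not monotone.\<close>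

lemma mid_negligible_transfer:
  assumes A: "pos_law A" and min: "minorizes G A 1" and mid: "mid_negligible A G"
  shows "mid_negligible G G"
  unfolding mid_negligible_def
proof (intro allI impI)
  fix \<delta> :: real assume \<delta>: "0 < \<delta>"
  have "\<forall>\<^sub>F x in at_top. 1/2 * 1 * D G x \<le> D A x"
    using min unfolding minorizes_def by (auto dest!: spec[of _ "1/2"])
  then obtain x0 where x0: "\<And>x. x0 \<le> x \<Longrightarrow> D G x \<le> 2 * D A x"
    unfolding eventually_at_top_linorder by (auto simp: field_simps)
  have "\<forall>\<^sub>F h in at_top. \<forall>\<^sub>F x in at_top. mid A G h x \<le> \<delta> / 2 * D G x"
    using mid \<delta> unfolding mid_negligible_def by (meson half_gt_zero)
  then show "\<forall>\<^sub>F h in at_top. \<forall>\<^sub>F x in at_top. mid G G h x \<le> \<delta> * D G x"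
    using eventually_ge_at_top[of x0]
  proof eventually_elim
    case (elim h)
    from elim(1) show ?case
    proof eventually_elim
      case (elim x)
      have "mid G G h x \<le> 2 * mid A G h x"
        using \<open>x0 \<le> h\<close> by (intro slab_mono[OF law A law]) (auto intro!: x0)
      with elim show ?case by simp
    qed
  qed
qed

end
subsection \<open>Iterated convolutions and Poisson mixtures\<close>

fun conv_iter :: "real measure \<Rightarrow> real measure \<Rightarrow> nat \<Rightarrow> real measure" where
  "conv_iter B G 0 = B"
| "conv_iter B G (Suc n) = (conv_iter B G n \<star> G)"

lemma pos_law_conv_iter: "pos_law B \<Longrightarrow> pos_law G \<Longrightarrow> pos_law (conv_iter B G n)"
  by (induction n) (auto intro: pos_law_convolution)

definition poisson_weight :: "real \<Rightarrow> nat \<Rightarrow> real" where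
  "poisson_weight m n = m ^ n / fact n * exp (- m)"

lemma poisson_weight_pos: "0 < m \<Longrightarrow> 0 < poisson_weight m n"
  by (simp add: poisson_weight_def)

lemma poisson_weight_power_sums: "(\<lambda>n. poisson_weight m n * q ^ n) sums exp (m * (q - 1))"
proof -
  have "(\<lambda>n. (m * q) ^ n /\<^sub>R fact n * exp (- m)) sums (exp (m * q) * exp (- m))"
    by (intro sums_mult2 exp_converges)
  moreover have "(m * q) ^ n /\<^sub>R fact n * exp (- m) = poisson_weight m n * q ^ n" for n
    by (simp add: poisson_weight_def power_mult_distrib field_simps)
  ultimately show ?thesis by (simp add: mult_exp_exp right_diff_distrib)
qed

text \<open>The relation m p(n) = (n + 1) p(n + 1) reduces the mean to the total mass.\<close>

lemma poisson_weight_mean_sums: "(\<lambda>n. poisson_weight m n * real n) sums m"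
proof -
  have "(\<lambda>n. poisson_weight m n * 1 ^ n) sums 1"
    using poisson_weight_power_sums[of m 1] by simp
  then have "(\<lambda>n. m * poisson_weight m n) sums m"
    using sums_mult[of "poisson_weight m" 1 m] by simp
  moreover have "m * poisson_weight m n = poisson_weight m (Suc n) * real (Suc n)" for n
    by (simp add: poisson_weight_def field_simps del: of_nat_Suc)
  ultimately have "(\<lambda>n. poisson_weight m (Suc n) * real (Suc n)) sums m" by simp
  from sums_Suc[OF this] show ?thesis by simp
qed

section \<open>Monotone tails for the infinite window, and limits of mixtures\<close>

context window
begin

lemma slab_Un:
  assumes A: "pos_law A" and B: "pos_law B" and V: "V \<in> sets borel" and W: "W \<in> sets borel" and "V \<inter> W = {}"
  shows "slab A B (V \<union> W) x = slab A B V x + slab A B W x"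
proof -
  interpret A: prob_space A by (rule pos_lawD[OF A])
  interpret B: prob_space B by (rule pos_lawD[OF B])
  interpret pair_prob_space A B ..
  have S: "{p. snd p \<in> U \<and> fst p + snd p \<in> shift_int T x} \<in> sets (A \<Otimes>\<^sub>M B)" if "U \<in> sets borel" for U
    using pair_event_sets[OF pos_lawD(2)[OF A] pos_lawD(2)[OF B] _ that, of UNIV x] by simp
  show ?thesis
    unfolding slab_def using assms(5)
    by (subst finite_measure_Union[symmetric]) (auto intro!: S V W arg_cong[where f=prob])
qed

lemma slab_UNIV:
  assumes A: "pos_law A" and B: "pos_law B"
  shows "slab A B UNIV x = D (A \<star> B) x"
  by (simp add: slab_def D_convolution[OF A B])

lemma D_antimono_infinite:
  assumes T: "T = \<infinity>" and M: "pos_law M" and "x \<le> y"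
  shows "D M y \<le> D M x"
proof -
  interpret M: prob_space M by (rule pos_lawD[OF M])
  show ?thesis
    unfolding T shift_int_PInf
    by (rule M.finite_measure_mono) (use assms(3) pos_lawD(2)[OF M] in auto)
qed

lemma D_negative_infinite:
  assumes T: "T = \<infinity>" and M: "pos_law M" and "x < 0"
  shows "D M x = 1"
proof -
  interpret M: prob_space M by (rule pos_lawD[OF M])
  have "AE y in M. y \<in> {x<..}"
    using pos_lawD(3)[OF M] by eventually_elim (use assms(3) in auto)
  moreover have "{x<..} \<in> sets M" using pos_lawD(2)[OF M] by simp
  ultimately show ?thesis unfolding T shift_int_PInf by (simp add: M.prob_eq_1)
qed

text \<open>Monotone tails replace long-tailedness, which is not yet known when this is applied. If
  Z \<le> x it is enough that Y > x; if Z > x the sum exceeds x whatever Y \<ge> 0 is. Only two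
  losses occur, hence a square root.\<close>

lemma minorizes_convolution_infinite:
  assumes T: "T = \<infinity>" and A: "pos_law A" and G: "pos_law G" and c: "0 \<le> c" and min: "minorizes G A c"
  shows "minorizes G (A \<star> G) (c + 1)"
  unfolding minorizes_def
proof (intro allI impI)
  interpret A: prob_space A by (rule pos_lawD[OF A])
  interpret G: prob_space G by (rule pos_lawD[OF G])
  fix \<theta> :: real assume \<theta>: "0 < \<theta>" "\<theta> < 1"
  define \<eta> where "\<eta> = sqrt \<theta>"
  have \<eta>: "0 < \<eta>" "\<eta> < 1" "\<eta> * \<eta> = \<theta>" using \<theta> by (auto simp: \<eta>_def)
  have "\<forall>\<^sub>F x in at_top. \<eta> * c * D G x \<le> D A x"
    using min \<eta> by (simp add: minorizes_def)
  then show "\<forall>\<^sub>F x in at_top. \<theta> * (c + 1) * D G x \<le> D (A \<star> G) x"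
    using eventually_prefix_mass[OF G \<eta>(2)]
  proof eventually_elim
    case (elim x)
    have "D A x * measure G {..x} \<le> slab A G {..x} x"
      by (rule slab_ge[OF A G]) (auto intro!: D_antimono_infinite[OF T A])
    moreover have "1 * measure G {x<..} \<le> slab A G {x<..} x"
      by (rule slab_ge[OF A G]) (auto simp: D_negative_infinite[OF T A])
    moreover have "slab A G {..x} x + slab A G {x<..} x = D (A \<star> G) x"
    proof -
      have "{..x} \<union> {x<..} = UNIV" by auto
      then show ?thesis
        using slab_Un[OF A G, of "{..x}" "{x<..}" x] slab_UNIV[OF A G, of x] by (auto simp: disjoint_iff)
    qed
    moreover have "\<eta> * c * D G x * \<eta> \<le> D A x * measure G {..x}"
      using elim \<eta> c by (intro mult_mono) auto
    moreover have "measure G {x<..} = D G x" by (simp add: T shift_int_PInf)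
    moreover have "\<theta> * D G x \<le> D G x" using \<theta> by (intro mult_left_le_one_le) auto
    ultimately show ?case by (simp add: \<eta>(3)[symmetric] algebra_simps)
  qed
qed

text \<open>Cut the second summand at 1 and at x. Between the cuts the first summand only has to
  exceed x - 1, so a \<open>D G (x - 1)\<close> noticeably larger than \<open>D G x\<close> would
  push the tail of G * G above 2 \<open>D G x\<close>.\<close>

lemma L_Delta_infinite:
  assumes T: "T = \<infinity>" and G: "pos_law G" and pos: "\<And>x. 0 < D G x" and maj: "majorizes G (G \<star> G) 2"
  shows "L_Delta T G"
proof -
  interpret G: prob_space G by (rule pos_lawD[OF G])
  have anti: "D G y \<le> D G x" if "x \<le> y" for x y
    by (rule D_antimono_infinite[OF T G that])
  have D1: "D G x = 1 - measure G {..x}" for x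
    using pos_lawD[OF G] G.prob_compl[of "{..x}"]
    by (auto simp: T shift_int_PInf Compl_eq_Diff_UNIV[symmetric])
  have step: "\<forall>\<^sub>F x in at_top. D G (x - 1) \<le> (1 + e) * D G x" if e: "0 < e" for e
  proof -
    \<comment> \<open>\<open>s\<close> weighs the summands beyond 1, from which the gain comes;
      scaling the slack by it lets \<open>s\<close> cancel. The value of \<delta> below solves (1 +
      \<delta>) / (1 - \<delta>) = 1 + e.\<close>
    define s where "s = D G 1"
    define \<delta> where "\<delta> = e / (2 + e)"
    have s: "0 < s" using pos by (simp add: s_def)
    have \<delta>: "0 < \<delta>" "\<delta> < 1" "1 + \<delta> = (1 + e) * (1 - \<delta>)" using e by (auto simp: \<delta>_def field_simps)
    have "\<forall>\<^sub>F x in at_top. D (G \<star> G) x \<le> (2 + s * \<delta>) * D G x"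
      using maj s \<delta> by (simp add: majorizes_def)
    moreover have "\<forall>\<^sub>F x in at_top. 1 - s * \<delta> \<le> measure G {..x}"
      using eventually_prefix_mass[OF G, of "1 - s * \<delta>"] s \<delta> by (auto elim: eventually_mono)
    ultimately show ?thesis
      using eventually_ge_at_top[of 1]
    proof eventually_elim
      case (elim x)
      have "D G x * measure G {..1} \<le> slab G G {..1} x"
        by (rule slab_ge[OF G G]) (auto intro!: anti)
      moreover have "D G (x - 1) * measure G {1<..x} \<le> slab G G {1<..x} x"
        by (rule slab_ge[OF G G]) (auto intro!: anti)
      moreover have "1 * measure G {x<..} \<le> slab G G {x<..} x"
        by (rule slab_ge[OF G G]) (auto simp: D_negative_infinite[OF T G])
      moreover have "slab G G {..1} x + slab G G {1<..x} x + slab G G {x<..} x = D (G \<star> G) x"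
      proof -
        have "{..1} \<union> {1<..x} = {..x}" "{..x} \<union> {x<..} = UNIV" using elim(3) by auto
        then show ?thesis
          using slab_Un[OF G G, of "{..1}" "{1<..x}" x] slab_Un[OF G G, of "{..x}" "{x<..}" x]
            slab_UNIV[OF G G, of x] by (auto simp: disjoint_iff)
      qed
      moreover have "measure G {x<..} = D G x" by (simp add: T shift_int_PInf)
      moreover have "measure G {1<..x} = s - D G x"
      proof -
        have "measure G {1<..x} = measure G ({..x} - {..1})"
          by (intro arg_cong[where f="measure G"]) auto
        also have "\<dots> = measure G {..x} - measure G {..1}"
          using elim(3) pos_lawD(2)[OF G] by (intro G.finite_measure_Diff) auto
        finally show ?thesis by (simp add: s_def D1)
      qed
      moreover have "measure G {..1} = 1 - s" by (simp add: s_def D1)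
      ultimately have "D G (x - 1) * (s - D G x) \<le> s * (1 + \<delta>) * D G x"
        using elim(1) by (simp add: algebra_simps)
      moreover have "D G (x - 1) * (s * (1 - \<delta>)) \<le> D G (x - 1) * (s - D G x)"
        using elim(2) by (intro mult_left_mono) (auto simp: D1 algebra_simps)
      ultimately have "(s * (1 - \<delta>)) * D G (x - 1) \<le> (s * (1 - \<delta>)) * ((1 + e) * D G x)"
        by (simp add: \<delta>(3) mult_ac)
      then show ?case using s \<delta> by (simp add: mult_le_cancel_left_pos)
    qed
  qed
  show ?thesis
    unfolding L_Delta_def
  proof (intro conjI allI impI)
    fix e :: real assume e: "0 < e"
    have "\<forall>\<^sub>F x in at_top. D G x \<le> (1 + e) * D G (x + 1)"
      using step[OF e] unfolding eventually_at_top_linorder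
      by (metis add_diff_cancel_right' add_increasing2 zero_le_one)
    then show "\<forall>\<^sub>F x in at_top. \<forall>t\<in>{0..1}. \<bar>D G (x + t) / D G x - 1\<bar> < e"
    proof eventually_elim
      case (elim x)
      show ?case
      proof
        fix t :: real assume t: "t \<in> {0..1}"
        have "D G x \<le> (1 + e) * D G (x + t)"
          using elim e anti[of "x + t" "x + 1"] t
          by (intro order_trans[OF elim] mult_left_mono) auto
        then have "1 / (1 + e) \<le> D G (x + t) / D G x"
          using pos[of x] e by (simp add: field_simps)
        moreover have "1 - e < 1 / (1 + e)" using e by (simp add: field_simps)
        moreover have "D G (x + t) / D G x \<le> 1"
          using pos[of x] anti[of x "x + t"] t by simp
        ultimately show "\<bar>D G (x + t) / D G x - 1\<bar> < e" using e by linarith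
      qed
    qed
  qed (simp add: pos)
qed

text \<open>The lower bounds of the components already average to \<mu>, the upper bound of the
  mixture. Any excess of component k would appear in the mixture with positive weight
  \<open>w k\<close>.\<close>

lemma mixture_component_majorizes:
  assumes sums: "\<And>x. (\<lambda>n. w n * D (H n) x) sums D F x"
    and w: "\<And>n. 0 < w n" and mean: "(\<lambda>n. w n * real n) sums \<mu>"
    and min: "\<And>n. minorizes G (H n) (real n)" and maj: "majorizes G F \<mu>"
  shows "majorizes G (H k) (real k)"
  unfolding majorizes_def
proof (intro allI impI)
  fix e :: real assume e: "0 < e"
  \<comment> \<open>Three losses of size d: truncating the mean at N, the factor \<theta> in the
    finitely many lower bounds, and the slack in the upper bound for F.\<close>
  define d where "d = e * w k / 3"
  have d: "0 < d" using e w by (simp add: d_def)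
  have "\<forall>\<^sub>F N in sequentially. \<mu> - d < (\<Sum>n<N. w n * real n)"
    using mean d by (intro order_tendstoD) (auto simp: sums_def)
  then have "\<forall>\<^sub>F N in sequentially. \<mu> - d < (\<Sum>n<N. w n * real n) \<and> k < N"
    using eventually_gt_at_top[of k] by eventually_elim simp
  from eventually_happens[OF this] obtain N where N: "\<mu> - d < (\<Sum>n<N. w n * real n)" "k < N" by auto
  define I where "I = {..<N} - {k}"
  have I: "finite I" "{..<N} = insert k I" "k \<notin> I" using N by (auto simp: I_def)
  define S where "S = (\<Sum>n\<in>I. w n * real n)"
  have "0 \<le> S" unfolding S_def by (intro sum_nonneg mult_nonneg_nonneg less_imp_le[OF w]) simp
  moreover have "\<mu> - d < w k * real k + S" using N I by (simp add: S_def)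
  ultimately have S: "0 \<le> S" "\<mu> - d < w k * real k + S" .
  define \<theta> where "\<theta> = 1 - min (1/2) (d / (S + 1))"
  have \<theta>: "0 < \<theta>" "\<theta> < 1" using d S by (auto simp: \<theta>_def)
  have "(1 - \<theta>) * S \<le> d / (S + 1) * S" using S by (intro mult_right_mono) (auto simp: \<theta>_def)
  also have "\<dots> \<le> d" using d S by (simp add: field_simps)
  finally have \<theta>S: "S - d \<le> \<theta> * S" by (simp add: algebra_simps)
  have "\<forall>\<^sub>F x in at_top. \<forall>n\<in>I. \<theta> * real n * D G x \<le> D (H n) x"
    using min \<theta> by (intro eventually_ball_finite I) (auto simp: minorizes_def)
  moreover have "\<forall>\<^sub>F x in at_top. D F x \<le> (\<mu> + d) * D G x"
    using maj d by (simp add: majorizes_def)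
  ultimately show "\<forall>\<^sub>F x in at_top. D (H k) x \<le> (real k + e) * D G x"
  proof eventually_elim
    case (elim x)
    have "(\<Sum>n<N. w n * D (H n) x) \<le> D F x"
      using sum_le_suminf[OF sums_summable[OF sums[of x]], of "{..<N}"] w sums_unique[OF sums[of x]]
      by (simp add: less_imp_le)
    then have "w k * D (H k) x + (\<Sum>n\<in>I. w n * D (H n) x) \<le> (\<mu> + d) * D G x"
      using I elim(2) by simp
    moreover have "(S - d) * D G x \<le> (\<Sum>n\<in>I. w n * D (H n) x)"
    proof -
      have "(S - d) * D G x \<le> \<theta> * S * D G x" using \<theta>S by (intro mult_right_mono) auto
      also have "\<dots> = (\<Sum>n\<in>I. w n * (\<theta> * real n * D G x))"
        by (simp add: S_def sum_distrib_left sum_distrib_right mult_ac)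
      also have "\<dots> \<le> (\<Sum>n\<in>I. w n * D (H n) x)"
        using elim(1) w by (intro sum_mono mult_left_mono) (auto simp: less_imp_le)
      finally show ?thesis .
    qed
    ultimately have "w k * D (H k) x \<le> (\<mu> + d - (S - d)) * D G x" by (simp add: algebra_simps)
    also have "\<dots> \<le> (w k * real k + 3 * d) * D G x" using S by (intro mult_right_mono) auto
    also have "\<dots> = w k * ((real k + e) * D G x)" by (simp add: d_def algebra_simps)
    finally show ?case using w[of k] by (simp add: mult_le_cancel_left_pos)
  qed
qed

text \<open>Dominated convergence for series. The domination must hold for all n beyond one common
  x1, since the limit in x is taken under the sum.\<close>

lemma mixture_ratio_tendsto:
  assumes sums: "\<And>x. (\<lambda>n. w n * D (H n) x) sums D F x"
    and w: "\<And>n. 0 < w n" and mean: "(\<lambda>n. w n * real n) sums \<mu>"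
    and lim: "\<And>n. ((\<lambda>x. D (H n) x / D G x) \<longlongrightarrow> real n) at_top"
    and bound: "\<And>x n. x1 \<le> x \<Longrightarrow> 0 < D G x \<and> D (H n) x \<le> M ^ n * D G x"
    and summ: "summable (\<lambda>n. w n * M ^ n)"
  shows "((\<lambda>x. D F x / D G x) \<longlongrightarrow> \<mu>) at_top"
proof -
  let ?a = "\<lambda>n x. w n * (D (H n) x / D G x)"
  have "\<forall>\<^sub>F (n, x) in at_top \<times>\<^sub>F at_top. norm (?a n x) \<le> w n * M ^ n"
    unfolding case_prod_unfold
  proof (rule eventually_mono)
    show "\<forall>\<^sub>F p in at_top \<times>\<^sub>F at_top. x1 \<le> snd (p :: nat \<times> real)"
      unfolding eventually_prod_filter
      by (rule exI[of _ "\<lambda>_. True"], rule exI[of _ "\<lambda>x. x1 \<le> x"]) (auto simp: eventually_ge_at_top)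
    fix p :: "nat \<times> real" assume p: "x1 \<le> snd p"
    then show "norm (?a (fst p) (snd p)) \<le> w (fst p) * M ^ fst p"
      using bound[OF p, of "fst p"] w[of "fst p"]
      by (auto simp: abs_mult pos_divide_le_eq intro!: mult_left_mono)
  qed
  from tannerys_theorem[OF tendsto_mult[OF tendsto_const lim] this summ]
  have "((\<lambda>x. \<Sum>n. ?a n x) \<longlongrightarrow> (\<Sum>n. w n * real n)) at_top" by simp
  moreover have "(\<Sum>n. ?a n x) = D F x / D G x" for x
    using sums_divide[OF sums[of x], of "D G x"] by (simp add: sums_iff)
  ultimately show ?thesis using mean by (simp add: sums_iff)
qed

end

section \<open>Light initial laws and domination of iterated convolutions\<close>

context long_tailed_law
begin

text \<open>Taking ratio 2 in the long-tail condition shows that window masses lose at most half per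
  unit length, from one fixed point onwards.\<close>

lemma doubling_bound:
  obtains x1 where "\<And>x. x1 \<le> x \<Longrightarrow> 0 < D G x"
    and "\<And>x t n. x1 \<le> x \<Longrightarrow> 0 \<le> t \<Longrightarrow> t \<le> real n \<Longrightarrow> D G x \<le> 2 ^ n * D G (x + t)"
proof -
  have "\<forall>\<^sub>F x in at_top. 0 < D G x \<and> (\<forall>t\<in>{0..1}. D G (x + t) \<le> 2 * D G x \<and> D G x \<le> 2 * D G (x + t))"
    using D_pos ratio_unit[of 2] by (intro eventually_conj) auto
  then obtain x1 where x1: "\<And>x. x1 \<le> x \<Longrightarrow> 0 < D G x"
    "\<And>x t. x1 \<le> x \<Longrightarrow> t \<in> {0..1} \<Longrightarrow> D G x \<le> 2 * D G (x + t)"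
    unfolding eventually_at_top_linorder by blast
  have "D G x \<le> 2 ^ n * D G (x + t)" if "x1 \<le> x" "0 \<le> t" "t \<le> real n" for x t n
    using that
  proof (induction n arbitrary: t)
    case (Suc n)
    define s where "s = min t (real n)"
    have "D G x \<le> 2 ^ n * D G (x + s)" using Suc by (intro Suc.IH) (auto simp: s_def)
    also have "\<dots> \<le> 2 ^ n * (2 * D G (x + s + (t - s)))"
      using Suc.prems by (intro mult_left_mono x1) (auto simp: s_def)
    finally show ?case by (simp add: mult_ac)
  qed simp
  with x1(1) that show ?thesis by blast
qed

text \<open>By \<open>doubling_bound\<close>, \<open>D G\<close> is at least of order exp(-x),
  because 2 \<le> e. A tail of order exp(-2x) leaves a whole factor exp(-x) that tends to 0.\<close>

lemma light_tail_majorizes: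
  assumes B: "pos_law B" and tail: "\<And>x. measure B {x<..} \<le> K * exp (- 2 * x)"
  shows "majorizes G B 0"
  unfolding majorizes_def
proof (intro allI impI)
  interpret B: prob_space B by (rule pos_lawD[OF B])
  fix e :: real assume e: "0 < e"
  obtain x1 where x1: "\<And>x. x1 \<le> x \<Longrightarrow> 0 < D G x"
    "\<And>x t n. x1 \<le> x \<Longrightarrow> 0 \<le> t \<Longrightarrow> t \<le> real n \<Longrightarrow> D G x \<le> 2 ^ n * D G (x + t)"
    using doubling_bound by blast
  define g where "g = D G x1"
  have g: "0 < g" using x1 by (simp add: g_def)
  have "((\<lambda>x::real. K * exp (1 - x1) * exp (- x)) \<longlongrightarrow> K * exp (1 - x1) * 0) at_top"
    by (intro tendsto_intros filterlim_compose[OF exp_at_bot] filterlim_uminus_at_bot_at_top)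
  then have "\<forall>\<^sub>F x in at_top. K * exp (1 - x1) * exp (- x) < e * g"
    using e g by (intro order_tendstoD) auto
  then show "\<forall>\<^sub>F x in at_top. D B x \<le> (0 + e) * D G x"
    using eventually_ge_at_top[of x1]
  proof eventually_elim
    case (elim x)
    define n where "n = nat \<lceil>x - x1\<rceil>"
    have n: "x - x1 \<le> real n" "real n \<le> x - x1 + 1" using elim(2) by (auto simp: n_def)
    have "(2::real) \<le> exp 1" using exp_ge_add_one_self[of 1] by simp
    then have "(2::real) ^ n \<le> exp 1 ^ n" by (rule power_mono) simp
    also have "\<dots> = exp (real n)" by (simp add: exp_of_nat_mult[symmetric])
    also have "\<dots> \<le> exp (x - x1 + 1)" using n by simp
    finally have 2: "(2::real) ^ n \<le> exp (x - x1 + 1)" .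
    have "g \<le> 2 ^ n * D G x" using x1(2)[of x1 "x - x1" n] elim n by (simp add: g_def)
    also have "\<dots> \<le> exp (x - x1 + 1) * D G x" using 2 by (rule mult_right_mono) simp
    finally have gx: "g \<le> exp (x - x1 + 1) * D G x" .
    have "D B x \<le> measure B {x<..}"
      using pos_lawD(2)[OF B] by (intro B.finite_measure_mono) (auto dest: shift_int_gt)
    also have "\<dots> \<le> K * exp (- 2 * x)" by (rule tail)
    \<comment> \<open>One factor exp(-x) absorbs the constants; the other, normalised as exp(x1 - 1
      - x), is the exact inverse of the factor in \<open>gx\<close>.\<close>
    also have "\<dots> = K * exp (1 - x1) * exp (- x) * exp (x1 - 1 - x)"
      by (simp add: mult_exp_exp mult.assoc)
    also have "\<dots> \<le> e * g * exp (x1 - 1 - x)"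
      using elim(1) by (intro mult_right_mono) auto
    also have "\<dots> \<le> e * (exp (x - x1 + 1) * D G x) * exp (x1 - 1 - x)"
      using gx e by (intro mult_right_mono mult_left_mono) auto
    also have "\<dots> = e * D G x * (exp (x - x1 + 1) * exp (x1 - 1 - x))" by (simp add: mult_ac)
    also have "\<dots> = e * D G x" by (simp add: mult_exp_exp)
    finally show ?case by simp
  qed
qed

lemma minorizes_conv_iter:
  assumes "pos_law B"
  shows "minorizes G (conv_iter B G n) (real n)"
proof (induction n)
  case (Suc n)
  then show ?case
    using minorizes_convolution[OF pos_law_conv_iter[OF assms law] _ Suc] by (simp add: add.commute)
qed (simp add: minorizes_0)

lemma majorizes_conv_iter:
  assumes "pos_law B" "majorizes G B 0" "mid_negligible G G"
  shows "majorizes G (conv_iter B G n) (real n)"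
proof (induction n)
  case (Suc n)
  then show ?case
    using majorizes_convolution[OF pos_law_conv_iter[OF assms(1) law] _ Suc assms(3)] by (simp add: add.commute)
qed (simp add: assms)

text \<open>A constant factor per convolution suffices here, in place of Kesten's bound, since the
  Poisson weights decay faster than any geometric sequence.\<close>

lemma conv_iter_geometric_bound:
  assumes B: "pos_law B" and maj: "majorizes G B 0" and sub: "majorizes G (G \<star> G) 2"
  obtains x1 M where "\<And>x n. x1 \<le> x \<Longrightarrow> 0 < D G x \<and> D (conv_iter B G n) x \<le> M ^ n * D G x"
proof -
  obtain x0 where x0: "\<And>x. x0 \<le> x \<Longrightarrow> 0 < D G x"
    "\<And>x t n. x0 \<le> x \<Longrightarrow> 0 \<le> t \<Longrightarrow> t \<le> real n \<Longrightarrow> D G x \<le> 2 ^ n * D G (x + t)"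
    using doubling_bound by blast
  have "\<forall>\<^sub>F x in at_top. D B x \<le> (0 + 1) * D G x \<and> D (G \<star> G) x \<le> (2 + 1) * D G x \<and> x0 \<le> x \<and> 0 \<le> x"
    using maj[unfolded majorizes_def, rule_format, of 1] sub[unfolded majorizes_def, rule_format, of 1]
    by (intro eventually_conj eventually_ge_at_top) auto
  then obtain x1 where x1: "\<And>x. x1 \<le> x \<Longrightarrow> D B x \<le> D G x" "\<And>x. x1 \<le> x \<Longrightarrow> D (G \<star> G) x \<le> 3 * D G x"
    "x0 \<le> x1" "0 \<le> x1"
    unfolding eventually_at_top_linorder by auto
  obtain n1 where n1: "x1 \<le> real n1" using real_arch_simple by blast
  define k where "k = (2::real) ^ n1"
  define g where "g = D G x1"
  have g: "0 < g" using x0 x1 by (simp add: g_def)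
  \<comment> \<open>The 3 comes from the bound on G * G, the two \<open>k\<close> from the slab with
    H_n \<le> x1 and from the corner, and \<open>k / g\<close> from the initial range of x.\<close>
  define M where "M = 3 + 2 * k + k / g"
  have k: "1 \<le> k" by (simp add: k_def)
  have M: "3 + 2 * k \<le> M" "k / g \<le> M" "1 \<le> M" using k g by (auto simp: M_def)
  have "D (conv_iter B G n) x \<le> M ^ n * D G x" if "x1 \<le> x" for n x
    using that
  proof (induction n arbitrary: x)
    case 0
    then show ?case using x1 by simp
  next
    case (Suc n)
    let ?H = "conv_iter B G n"
    have H: "pos_law ?H" by (rule pos_law_conv_iter[OF B law])
    interpret H: prob_space ?H by (rule pos_lawD[OF H])
    interpret HG: prob_space "?H \<star> G" by (rule pos_lawD[OF pos_law_convolution[OF H law]])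
    have Mn: "1 \<le> M ^ n" using M by simp
    show ?case
    proof (cases "2 * x1 \<le> x")
      case False
      have "g \<le> k * D G x"
        using x0(2)[of x1 "x - x1" n1] Suc.prems False n1 x1 by (simp add: g_def k_def)
      then have "1 \<le> k / g * D G x" using g by (simp add: field_simps)
      also have "\<dots> \<le> M ^ Suc n * D G x"
        using M Mn by (intro mult_right_mono) (auto intro: order_trans[OF M(2)] simp: mult_le_cancel_left1)
      finally have "1 \<le> M ^ Suc n * D G x" .
      then show ?thesis using HG.prob_le_1 by (simp add: order_trans[OF HG.prob_le_1])
    next
      case True
      have near: "D G (x - y) \<le> k * D G x" if "0 \<le> y" "y \<le> x1" for y
        using x0(2)[of "x - y" y n1] that True n1 x1 by (simp add: k_def)
      \<comment> \<open>Merged, the two pieces cover z \<le> x - x1, exactly the range in which x -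
        z \<ge> x1 and the induction hypothesis applies under the integral.\<close>
      have "slab ?H G {..x1} x + mid ?H G x1 x = slab ?H G {..x-x1} x"
      proof -
        have "{..x1} \<union> {x1<..x-x1} = {..x-x1}" using True by auto
        then show ?thesis
          using slab_Un[OF H law, of "{..x1}" "{x1<..x-x1}" x] by (auto simp: disjoint_iff)
      qed
      also have "\<dots> \<le> M ^ n * slab G G {..x-x1} x"
        using Mn by (intro slab_mono[OF H law law] Suc.IH) auto
      also have "\<dots> \<le> M ^ n * (3 * D G x)"
      proof (intro mult_left_mono)
        have "{..x-x1} \<union> {x-x1<..} = UNIV" by auto
        then have "slab G G {..x-x1} x + slab G G {x-x1<..} x = D (G \<star> G) x"
          using slab_Un[OF law law, of "{..x-x1}" "{x-x1<..}" x] slab_UNIV[OF law law, of x]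
          by (auto simp: disjoint_iff)
        moreover have "0 \<le> slab G G {x-x1<..} x" by (simp add: slab_def)
        ultimately show "slab G G {..x-x1} x \<le> 3 * D G x" using x1(2)[OF Suc.prems] by linarith
      qed (use Mn in auto)
      finally have 1: "slab ?H G {..x1} x + mid ?H G x1 x \<le> M ^ n * (3 * D G x)" .
      have "slab G ?H {..x1} x \<le> k * D G x * measure ?H {..x1}"
        using k near by (intro slab_le[OF law H]) auto
      also have "\<dots> \<le> k * D G x" using k by (intro mult_right_le_one_le) auto
      also have "\<dots> \<le> M ^ n * (k * D G x)" using mult_right_mono[OF Mn, of "k * D G x"] k by simp
      finally have 2: "slab G ?H {..x1} x \<le> M ^ n * (k * D G x)" .
      have "D ?H x1 * D G (x - x1) \<le> 1 * (k * D G x)"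
        using near[of x1] x1 k by (intro mult_mono) auto
      also have "\<dots> \<le> M ^ n * (k * D G x)" using mult_right_mono[OF Mn, of "k * D G x"] k by simp
      finally have 3: "D ?H x1 * D G (x - x1) \<le> M ^ n * (k * D G x)" .
      have "D (?H \<star> G) x \<le> M ^ n * (3 + 2 * k) * D G x"
        using convolution_split(2)[OF H law True] 1 2 3 by (simp add: algebra_simps)
      also have "\<dots> \<le> M ^ n * M * D G x"
        using M Mn by (intro mult_right_mono mult_left_mono) auto
      finally show ?thesis by (simp add: mult_ac)
    qed
  qed
  with x0(1) x1(3) that show ?thesis by (meson order_trans)
qed

end
subsection \<open>Laplace transforms\<close>

lemma pos_law_real_distribution:
  assumes "pos_law M" shows "real_distribution M"
proof -
  interpret prob_space M by (rule pos_lawD[OF assms])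
  show ?thesis by unfold_locales (use pos_lawD[OF assms] in auto)
qed

text \<open>For X \<ge> 0 the variable exp(-X) takes values in [0,1], so its characteristic function
  equals its moment series, and its moments are the Laplace transform of X at the integers.\<close>

lemma char_exp_moments:
  assumes M: "pos_law M"
  shows "(\<lambda>n. (\<i> * t) ^ n / fact n * of_real (\<integral>x. exp (- real n * x) \<partial>M)) sums
    (\<integral>x. iexp (t * exp (- x)) \<partial>M)"
proof -
  interpret prob_space M by (rule pos_lawD[OF M])
  note [measurable_cong] = pos_lawD(2)[OF M]
  let ?f = "\<lambda>n x. (\<i> * t) ^ n / fact n * of_real (exp (- x) ^ n)"
  have bound: "AE x in M. norm (?f n x) \<le> \<bar>t\<bar> ^ n / fact n" for n
    using pos_lawD(3)[OF M]
  proof eventually_elim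
    case (elim x)
    have "norm (?f n x) = \<bar>t\<bar> ^ n / fact n * exp (- x) ^ n"
      by (simp add: norm_mult norm_divide norm_power)
    also have "\<dots> \<le> \<bar>t\<bar> ^ n / fact n * 1"
      using elim by (intro mult_left_mono power_le_one) auto
    finally show ?case by simp
  qed
  have int: "integrable M (?f n)" for n
    by (rule integrable_const_bound[OF bound]) measurable
  have summ: "summable (\<lambda>n. \<bar>t\<bar> ^ n / fact n)"
    using summable_exp[of "\<bar>t\<bar>"] by (simp only: divide_inverse mult.commute)
  have "(\<lambda>n. integral\<^sup>L M (?f n)) sums (\<integral>x. (\<Sum>n. ?f n x) \<partial>M)"
  proof (rule sums_integral)
    have "AE x in M. \<forall>n. norm (?f n x) \<le> \<bar>t\<bar> ^ n / fact n"
      using bound by (simp add: AE_all_countable)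
    then show "AE x in M. summable (\<lambda>n. norm (?f n x))"
      by eventually_elim (rule summable_comparison_test'[OF summ, of 0], simp)
    show "summable (\<lambda>n. \<integral>x. norm (?f n x) \<partial>M)"
    proof (rule summable_comparison_test'[OF summ, of 0])
      fix n
      have "(\<integral>x. norm (?f n x) \<partial>M) \<le> (\<integral>x. \<bar>t\<bar> ^ n / fact n \<partial>M)"
        by (rule integral_mono_AE[OF integrable_norm[OF int] _ bound]) simp
      then show "norm (\<integral>x. norm (?f n x) \<partial>M) \<le> \<bar>t\<bar> ^ n / fact n"
        by (simp add: prob_space)
    qed
  qed (rule int)
  moreover have "(\<Sum>n. ?f n x) = iexp (t * exp (- x))" for x
  proof -
    have "(\<lambda>n. (\<i> * t * exp (- x)) ^ n /\<^sub>R fact n) sums exp (\<i> * t * exp (- x))"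
      by (rule exp_converges)
    moreover have "(\<i> * t * exp (- x)) ^ n /\<^sub>R fact n = ?f n x" for n
      by (simp add: scaleR_conv_of_real power_mult_distrib divide_inverse mult_ac)
    ultimately show ?thesis by (simp add: sums_iff mult_ac)
  qed
  moreover have "integral\<^sup>L M (?f n) = (\<i> * t) ^ n / fact n * of_real (\<integral>x. exp (- real n * x) \<partial>M)" for n
  proof -
    have "exp (- x) ^ n = exp (- real n * x)" for x :: real
      by (simp add: exp_of_nat_mult[symmetric])
    then have "integral\<^sup>L M (?f n) = (\<integral>x. (\<i> * t) ^ n / fact n * of_real (exp (- real n * x)) \<partial>M)"
      by simp
    also have "\<dots> = (\<i> * t) ^ n / fact n * (\<integral>x. of_real (exp (- real n * x)) \<partial>M)"
      by (rule integral_mult_right_zero)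
    also have "\<dots> = (\<i> * t) ^ n / fact n * of_real (\<integral>x. exp (- real n * x) \<partial>M)"
      by (simp only: integral_complex_of_real)
    finally show ?thesis .
  qed
  ultimately show ?thesis by (simp only:)
qed

text \<open>The values at the integers fix the characteristic function of exp(-X), hence its law by
  Levy's uniqueness theorem; pushing forward by -ln recovers the law of X.\<close>

lemma laplace_unique:
  assumes A: "pos_law A" and B: "pos_law B"
    and eq: "\<And>n::nat. (\<integral>x. exp (- real n * x) \<partial>A) = (\<integral>x. exp (- real n * x) \<partial>B)"
  shows "A = B"
proof -
  note [measurable_cong] = pos_lawD(2)[OF A] pos_lawD(2)[OF B]
  interpret A: real_distribution A by (rule pos_law_real_distribution[OF A])
  interpret B: real_distribution B by (rule pos_law_real_distribution[OF B])
  let ?d = "\<lambda>M. distr M borel (\<lambda>x::real. exp (- x))"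
  have "?d A = ?d B"
  proof (rule Levy_uniqueness)
    show "char (?d A) = char (?d B)"
    proof
      fix t
      have "char (?d A) t = (\<integral>x. iexp (t * exp (- x)) \<partial>A)"
        unfolding char_def by (subst integral_distr) auto
      also have "\<dots> = (\<integral>x. iexp (t * exp (- x)) \<partial>B)"
        using char_exp_moments[OF A, of t] char_exp_moments[OF B, of t] unfolding eq by (rule sums_unique2)
      also have "\<dots> = char (?d B) t"
        unfolding char_def by (subst integral_distr) auto
      finally show "char (?d A) t = char (?d B) t" .
    qed
  qed (auto intro!: A.real_distribution_distr B.real_distribution_distr)
  then have "distr (?d A) borel (\<lambda>u. - ln u) = distr (?d B) borel (\<lambda>u. - ln u)" by simp
  moreover have "distr (?d M) borel (\<lambda>u. - ln u) = M" if "sets M = sets borel" for M :: "real measure"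
  proof -
    note [measurable_cong] = that
    have "distr (?d M) borel (\<lambda>u. - ln u) = distr M borel (\<lambda>x. x)"
      by (subst distr_distr) (auto simp: o_def)
    also have "\<dots> = M" using that by (intro distr_id2) simp
    finally show ?thesis .
  qed
  ultimately show ?thesis using pos_lawD(2)[OF A] pos_lawD(2)[OF B] by simp
qed

text \<open>Working with extended nonnegative integrals and any real s covers Laplace transforms and
  positive exponential moments at once, free of integrability conditions.\<close>

lemma nn_integral_exp_convolution:
  assumes A: "pos_law A" and B: "pos_law B"
  shows "(\<integral>\<^sup>+x. exp (s * x) \<partial>(A \<star> B)) = (\<integral>\<^sup>+x. exp (s * x) \<partial>A) * (\<integral>\<^sup>+x. exp (s * x) \<partial>B)"
proof -
  interpret A: prob_space A by (rule pos_lawD[OF A])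
  interpret B: prob_space B by (rule pos_lawD[OF B])
  note [measurable_cong] = pos_lawD(2)[OF A] pos_lawD(2)[OF B]
  have "(\<integral>\<^sup>+x. exp (s * x) \<partial>(A \<star> B)) = (\<integral>\<^sup>+x. \<integral>\<^sup>+y. exp (s * (x + y)) \<partial>B \<partial>A)"
    using pos_lawD(2)[OF A] pos_lawD(2)[OF B]
    by (intro nn_integral_convolution) (auto intro: A.finite_measure_axioms B.finite_measure_axioms)
  also have "\<dots> = (\<integral>\<^sup>+x. exp (s * x) * (\<integral>\<^sup>+y. exp (s * y) \<partial>B) \<partial>A)"
    by (intro nn_integral_cong, subst nn_integral_cmult[symmetric])
      (auto simp: distrib_left exp_add ennreal_mult)
  also have "\<dots> = (\<integral>\<^sup>+x. exp (s * x) \<partial>A) * (\<integral>\<^sup>+x. exp (s * x) \<partial>B)"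
    by (rule nn_integral_multc) measurable
  finally show ?thesis .
qed

lemma nn_integral_exp_conv_iter:
  assumes B: "pos_law B" and Q: "pos_law Q" and "0 \<le> b" "0 \<le> q"
    and "(\<integral>\<^sup>+x. exp (s * x) \<partial>B) = ennreal b" "(\<integral>\<^sup>+x. exp (s * x) \<partial>Q) = ennreal q"
  shows "(\<integral>\<^sup>+x. exp (s * x) \<partial>conv_iter B Q n) = ennreal (b * q ^ n)"
proof (induction n)
  case (Suc n)
  have "(\<integral>\<^sup>+x. exp (s * x) \<partial>conv_iter B Q (Suc n)) = ennreal (b * q ^ n) * ennreal q"
    unfolding conv_iter.simps nn_integral_exp_convolution[OF pos_law_conv_iter[OF B Q] Q] Suc assms(6) ..
  also have "\<dots> = ennreal (b * q ^ Suc n)"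
    using assms(3,4) by (simp add: ennreal_mult[symmetric] mult_ac)
  finally show ?case .
qed (use assms in simp)

text \<open>The law of Y + Z_1 + ... + Z_N with independent Y of law \<open>B\<close>, Z_i of law
  \<open>Q\<close> and a Poisson variable N of mean \<open>m\<close>. With \<open>B\<close> a point
  mass it is a compound Poisson law with drift; with \<open>B\<close> the law of the small jumps it
  is F.\<close>

definition poisson_mix :: "real \<Rightarrow> real measure \<Rightarrow> real measure \<Rightarrow> real measure" where
  "poisson_mix m B Q = measure_pmf (poisson_pmf m) \<bind> conv_iter B Q"

lemma poisson_mix:
  assumes m: "0 < m" and B: "pos_law B" and Q: "pos_law Q"
  shows pos_law_poisson_mix: "pos_law (poisson_mix m B Q)"
    and measure_poisson_mix_sums: "S \<in> sets borel \<Longrightarrow>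
      (\<lambda>n. poisson_weight m n * measure (conv_iter B Q n) S) sums measure (poisson_mix m B Q) S"
    and nn_integral_exp_poisson_mix: "0 \<le> b \<Longrightarrow> 0 \<le> q \<Longrightarrow>
      (\<integral>\<^sup>+x. exp (s * x) \<partial>B) = ennreal b \<Longrightarrow> (\<integral>\<^sup>+x. exp (s * x) \<partial>Q) = ennreal q \<Longrightarrow>
      (\<integral>\<^sup>+x. exp (s * x) \<partial>poisson_mix m B Q) = ennreal (b * exp (m * (q - 1)))"
proof -
  interpret P: prob_space "measure_pmf (poisson_pmf m)" by (rule prob_space_measure_pmf)
  note H = pos_law_conv_iter[OF B Q]
  have K [measurable]: "conv_iter B Q \<in> measurable (measure_pmf (poisson_pmf m)) (subprob_algebra borel)"
    using pos_lawD(1,2)[OF H]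
    by (auto simp: space_subprob_algebra intro: prob_space_imp_subprob_space)
  have sets: "sets (poisson_mix m B Q) = sets borel"
    unfolding poisson_mix_def by (rule sets_bind_measurable[OF K]) simp
  have nn: "(\<integral>\<^sup>+n. f n \<partial>measure_pmf (poisson_pmf m)) = (\<Sum>n. ennreal (poisson_weight m n) * f n)" for f
    by (simp add: nn_integral_measure_pmf nn_integral_count_space_nat pmf_poisson[OF m] poisson_weight_def)
  have "prob_space (poisson_mix m B Q)"
    unfolding poisson_mix_def using pos_lawD(1)[OF H] by (intro measure_pmf.prob_space_bind[OF _ K]) auto
  moreover have "AE x in poisson_mix m B Q. 0 \<le> x"
    unfolding poisson_mix_def using pos_lawD(3)[OF H] by (subst AE_bind[OF K]) auto
  ultimately show mix: "pos_law (poisson_mix m B Q)"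
    using sets by (simp add: pos_law_def)
  interpret M: prob_space "poisson_mix m B Q" by (rule pos_lawD[OF mix])
  show "(\<lambda>n. poisson_weight m n * measure (conv_iter B Q n) S) sums measure (poisson_mix m B Q) S"
    if "S \<in> sets borel"
  proof -
    have "emeasure (poisson_mix m B Q) S = (\<Sum>n. ennreal (poisson_weight m n) * emeasure (conv_iter B Q n) S)"
      unfolding poisson_mix_def using that by (subst emeasure_bind[OF _ K]) (auto simp: nn)
    also have "\<dots> = (\<Sum>n. ennreal (poisson_weight m n * measure (conv_iter B Q n) S))"
      using pos_lawD(1)[OF H] less_imp_le[OF poisson_weight_pos[OF m]]
      by (intro suminf_cong)
        (simp add: ennreal_mult finite_measure.emeasure_eq_measure prob_space_def)
    finally have eq: "ennreal (measure (poisson_mix m B Q) S) =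
        (\<Sum>n. ennreal (poisson_weight m n * measure (conv_iter B Q n) S))"
      by (simp add: M.emeasure_eq_measure)
    have summ: "summable (\<lambda>n. poisson_weight m n * measure (conv_iter B Q n) S)"
    proof (rule summable_comparison_test'[of "\<lambda>n. poisson_weight m n * 1 ^ n" 0])
      show "summable (\<lambda>n. poisson_weight m n * 1 ^ n)"
        by (rule sums_summable[OF poisson_weight_power_sums])
      show "norm (poisson_weight m n * measure (conv_iter B Q n) S) \<le> poisson_weight m n * 1 ^ n" for n
        using poisson_weight_pos[OF m, of n] prob_space.prob_le_1[OF pos_lawD(1)[OF H], of n S]
        by (simp add: abs_mult mult_le_cancel_left2)
    qed
    have nonneg: "0 \<le> poisson_weight m n * measure (conv_iter B Q n) S" for n
      using poisson_weight_pos[OF m, of n] by simp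
    have "ennreal (measure (poisson_mix m B Q) S) = ennreal (\<Sum>n. poisson_weight m n * measure (conv_iter B Q n) S)"
      unfolding eq using summ nonneg by (intro suminf_ennreal2)
    then show ?thesis
      using summ nonneg by (subst (asm) ennreal_inj) (auto simp: sums_iff intro: suminf_nonneg)
  qed
  show "(\<integral>\<^sup>+x. exp (s * x) \<partial>poisson_mix m B Q) = ennreal (b * exp (m * (q - 1)))"
    if "0 \<le> b" "0 \<le> q" "(\<integral>\<^sup>+x. exp (s * x) \<partial>B) = ennreal b" "(\<integral>\<^sup>+x. exp (s * x) \<partial>Q) = ennreal q"
  proof -
    have "(\<integral>\<^sup>+x. exp (s * x) \<partial>poisson_mix m B Q) = (\<Sum>n. ennreal (poisson_weight m n) * ennreal (b * q ^ n))"
      unfolding poisson_mix_def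
      by (subst nn_integral_bind[OF _ K]) (auto simp: nn nn_integral_exp_conv_iter[OF B Q that])
    also have "\<dots> = (\<Sum>n. ennreal (b * (poisson_weight m n * q ^ n)))"
      using that less_imp_le[OF poisson_weight_pos[OF m]] by (simp add: ennreal_mult[symmetric] mult_ac)
    also have "\<dots> = ennreal (b * exp (m * (q - 1)))"
      using that less_imp_le[OF poisson_weight_pos[OF m]] sums_mult[OF poisson_weight_power_sums[of m q], of b]
      by (intro suminf_ennreal_eq) auto
    finally show ?thesis .
  qed
qed
subsection \<open>The law of the small jumps\<close>

text \<open>Chernoff's bound routed through a bounded continuous majorant of the indicator, so that
  it survives weak limits.\<close>

lemma pos_law_clipped_exp:
  assumes M: "pos_law M" and K: "0 \<le> K" and mom: "(\<integral>\<^sup>+y. exp (2 * y) \<partial>M) \<le> ennreal K"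
  shows "(\<integral>y. min 1 (exp (2 * (y - x))) \<partial>M) \<le> K * exp (- 2 * x)"
    and "measure M {x<..} \<le> (\<integral>y. min 1 (exp (2 * (y - x))) \<partial>M)"
proof -
  interpret prob_space M by (rule pos_lawD[OF M])
  note [measurable_cong] = pos_lawD(2)[OF M]
  let ?f = "\<lambda>y. min 1 (exp (2 * (y - x)))"
  have int: "integrable M ?f" by (rule integrable_const_bound[of _ 1]) auto
  have "ennreal (\<integral>y. ?f y \<partial>M) = (\<integral>\<^sup>+y. ?f y \<partial>M)"
    using int by (intro nn_integral_eq_integral[symmetric]) auto
  also have "\<dots> \<le> (\<integral>\<^sup>+y. ennreal (exp (- 2 * x)) * ennreal (exp (2 * y)) \<partial>M)"
    by (intro nn_integral_mono) (simp add: ennreal_mult[symmetric] mult_exp_exp algebra_simps ennreal_leI)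
  also have "\<dots> = ennreal (exp (- 2 * x)) * (\<integral>\<^sup>+y. exp (2 * y) \<partial>M)"
    by (rule nn_integral_cmult) measurable
  also have "\<dots> \<le> ennreal (exp (- 2 * x)) * ennreal K"
    by (intro mult_left_mono mom) simp
  also have "\<dots> = ennreal (K * exp (- 2 * x))"
    using K by (simp add: ennreal_mult[symmetric] mult.commute)
  finally show "(\<integral>y. ?f y \<partial>M) \<le> K * exp (- 2 * x)"
    using K by (subst (asm) ennreal_le_iff) auto
  have "measure M {x<..} = (\<integral>y. indicator {x<..} y \<partial>M)" by simp
  also have "\<dots> \<le> (\<integral>y. ?f y \<partial>M)"
    by (rule integral_mono[OF _ int]) (auto intro!: integrable_const_bound[of _ 1] simp: indicator_def)
  finally show "measure M {x<..} \<le> (\<integral>y. ?f y \<partial>M)" .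
qed

text \<open>The common exponential moment gives tightness, hence a weakly convergent subsequence.
  Nonnegativity, the transform and the tail bound are each phrased with bounded continuous test
  functions and so pass to its limit.\<close>

lemma pos_law_weak_limit:
  assumes M: "\<And>k. pos_law (M k)" and K: "0 \<le> K"
    and mom: "\<And>k::nat. (\<integral>\<^sup>+y. exp (2 * y) \<partial>M k) \<le> ennreal K"
    and lim: "\<And>l. 0 \<le> l \<Longrightarrow> (\<lambda>k. \<integral>x. exp (- l * x) \<partial>M k) \<longlonglongrightarrow> \<Phi> l"
  obtains P where "pos_law P" "\<And>l. 0 \<le> l \<Longrightarrow> (\<integral>x. exp (- l * x) \<partial>P) = \<Phi> l"
    "\<And>x. measure P {x<..} \<le> K * exp (- 2 * x)"
proof -
  interpret M: real_distribution "M k" for k by (rule pos_law_real_distribution[OF M])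
  have "tight M"
    unfolding tight_def
  proof (intro conjI allI impI)
    fix \<epsilon> :: real assume \<epsilon>: "0 < \<epsilon>"
    have "((\<lambda>x::real. K * exp (- 2 * x)) \<longlongrightarrow> K * 0) at_top"
      by (intro tendsto_intros filterlim_compose[OF exp_at_bot])
        (simp add: filterlim_uminus_at_bot filterlim_tendsto_pos_mult_at_top[OF tendsto_const] filterlim_ident)
    then have "\<forall>\<^sub>F x in at_top. K * exp (- 2 * x) < \<epsilon>" using \<epsilon> by (intro order_tendstoD) auto
    then have "\<forall>\<^sub>F x in at_top. K * exp (- 2 * x) < \<epsilon> \<and> 0 < x"
      using eventually_gt_at_top[of 0] by eventually_elim simp
    from eventually_happens[OF this] obtain b where b: "K * exp (- 2 * b) < \<epsilon>" "0 < b" by auto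
    \<comment> \<open>The interval is open on the left; starting at -1 keeps a possible atom at
      0.\<close>
    have "1 - \<epsilon> < measure (M k) {-1<..b}" for k
    proof -
      have "measure (M k) {-1<..b} = measure (M k) (space (M k) - {b<..})"
        by (rule M.finite_measure_eq_AE, use pos_lawD(3)[OF M, of k] in eventually_elim) auto
      also have "\<dots> = 1 - measure (M k) {b<..}" by (rule M.prob_compl) auto
      finally have "measure (M k) {-1<..b} = 1 - measure (M k) {b<..}" .
      moreover have "measure (M k) {b<..} \<le> K * exp (- 2 * b)"
        by (rule order_trans[OF pos_law_clipped_exp(2,1)[OF M K mom]])
      ultimately show ?thesis using b by linarith
    qed
    then show "\<exists>a b. a < b \<and> (\<forall>n. 1 - \<epsilon> < measure (M n) {a<..b})"
      using b by (intro exI[of _ "-1"] exI[of _ b]) auto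
  qed (rule M.real_distribution_axioms)
  from tight_imp_convergent_subsubsequence[OF this strict_mono_id]
  obtain r P where r: "strict_mono (r :: nat \<Rightarrow> nat)" and P: "real_distribution P"
    and conv: "weak_conv_m (M \<circ> r) P" by auto
  interpret P: real_distribution P by (rule P)
  have "real_distribution ((M \<circ> r) k)" for k by (simp add: M.real_distribution_axioms)
  note wk = weak_conv_imp_integral_bdd_continuous_conv[OF this P conv]
  have nonneg: "AE x in P. 0 \<le> x"
  proof -
    let ?f = "\<lambda>x::real. min 1 (max 0 (- x))"
    have "(\<lambda>k. \<integral>x. ?f x \<partial>(M \<circ> r) k) \<longlonglongrightarrow> (\<integral>x. ?f x \<partial>P)"
      by (rule wk[of _ 1]) (auto intro!: continuous_intros)
    moreover have "(\<integral>x. ?f x \<partial>(M \<circ> r) k) = 0" for k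
    proof -
      have "AE x in (M \<circ> r) k. ?f x = 0"
        unfolding o_def using pos_lawD(3)[OF M, of "r k"] by eventually_elim simp
      then show ?thesis by (rule integral_eq_zero_AE)
    qed
    ultimately have "(\<integral>x. ?f x \<partial>P) = 0" by (simp add: LIMSEQ_const_iff)
    then have "AE x in P. ?f x = 0"
      by (subst (asm) integral_nonneg_eq_0_iff_AE) (auto intro!: P.integrable_const_bound[of _ 1])
    then show ?thesis by eventually_elim (auto simp: min_def max_def split: if_splits)
  qed
  then have pos: "pos_law P" by (simp add: pos_law_def P.prob_space_axioms)
  have "(\<integral>x. exp (- l * x) \<partial>P) = \<Phi> l" if l: "0 \<le> l" for l
  proof -
    \<comment> \<open>Clipping at 0 makes the exponential bounded on the whole line and changes
      nothing almost surely under laws on the half-line.\<close>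
    let ?f = "\<lambda>x::real. exp (- l * max 0 x)"
    have eq: "(\<integral>x. ?f x \<partial>N) = (\<integral>x. exp (- l * x) \<partial>N)" if "pos_law N" for N
    proof -
      note [measurable_cong] = pos_lawD(2)[OF that]
      show ?thesis
        by (rule integral_cong_AE, measurable, use pos_lawD(3)[OF that] in eventually_elim) simp
    qed
    have "(\<lambda>k. \<integral>x. ?f x \<partial>(M \<circ> r) k) \<longlonglongrightarrow> (\<integral>x. ?f x \<partial>P)"
      using l by (intro wk[of _ 1]) (auto intro!: continuous_intros)
    moreover have "(\<lambda>k. \<integral>x. ?f x \<partial>(M \<circ> r) k) \<longlonglongrightarrow> \<Phi> l"
      using LIMSEQ_subseq_LIMSEQ[OF lim[OF l] r] by (simp only: eq[OF M] o_def)
    ultimately show ?thesis unfolding eq[OF pos] by (rule LIMSEQ_unique)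
  qed
  moreover have "measure P {x<..} \<le> K * exp (- 2 * x)" for x
  proof -
    let ?f = "\<lambda>y::real. min 1 (exp (2 * (y - x)))"
    have "measure P {x<..} = (\<integral>y. indicator {x<..} y \<partial>P)" by simp
    also have "\<dots> \<le> (\<integral>y. ?f y \<partial>P)"
      by (rule integral_mono) (auto intro!: P.integrable_const_bound[of _ 1] simp: indicator_def)
    also have "\<dots> \<le> K * exp (- 2 * x)"
    proof (rule LIMSEQ_le_const2)
      show "(\<lambda>k. \<integral>x. ?f x \<partial>(M \<circ> r) k) \<longlonglongrightarrow> (\<integral>x. ?f x \<partial>P)"
        by (rule wk[of _ 1]) (auto intro!: continuous_intros)
      show "\<exists>N. \<forall>k\<ge>N. (\<integral>x. ?f x \<partial>(M \<circ> r) k) \<le> K * exp (- 2 * x)"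
        using pos_law_clipped_exp(1)[OF M K mom] by auto
    qed
    finally show ?thesis .
  qed
  ultimately show ?thesis using pos that by blast
qed

section \<open>Compound Poisson laws from restrictions of the Levy measure\<close>

definition normalized :: "real measure \<Rightarrow> real set \<Rightarrow> real measure" where
  "normalized \<nu> W = density \<nu> (\<lambda>x. indicator W x / ennreal (measure \<nu> W))"

lemma normalized:
  assumes [measurable_cong]: "sets \<nu> = sets borel" and W [measurable]: "W \<in> sets borel"
    and nonneg: "W \<subseteq> {0..}" and fin: "emeasure \<nu> W < \<infinity>" and pos: "0 < measure \<nu> W"
  shows pos_law_normalized: "pos_law (normalized \<nu> W)"
    and nn_integral_normalized: "f \<in> borel_measurable borel \<Longrightarrow>
      (\<integral>\<^sup>+x. f x \<partial>normalized \<nu> W) = (\<integral>\<^sup>+x. f x * indicator W x \<partial>\<nu>) / ennreal (measure \<nu> W)"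
proof -
  let ?m = "ennreal (measure \<nu> W)"
  have m: "emeasure \<nu> W = ?m" "?m \<noteq> 0" using fin pos by (auto simp: emeasure_eq_ennreal_measure)
  have nn: "(\<integral>\<^sup>+x. f x \<partial>normalized \<nu> W) = (\<integral>\<^sup>+x. f x * indicator W x \<partial>\<nu>) / ?m"
    if [measurable]: "f \<in> borel_measurable borel" for f
    unfolding normalized_def
    by (subst nn_integral_density) (auto simp: nn_integral_divide[symmetric] ennreal_times_divide mult.commute)
  then show "f \<in> borel_measurable borel \<Longrightarrow>
      (\<integral>\<^sup>+x. f x \<partial>normalized \<nu> W) = (\<integral>\<^sup>+x. f x * indicator W x \<partial>\<nu>) / ennreal (measure \<nu> W)" .
  have sets: "sets (normalized \<nu> W) = sets borel" by (simp add: normalized_def assms(1))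
  have "emeasure (normalized \<nu> W) (space (normalized \<nu> W)) = 1"
    using nn[of "\<lambda>_. 1"] m W assms(1) fin by (simp add: ennreal_divide_self)
  moreover have "AE x in normalized \<nu> W. 0 \<le> x"
    unfolding normalized_def using nonneg
    by (subst AE_density) (auto split: split_indicator)
  ultimately show "pos_law (normalized \<nu> W)"
    using sets by (auto simp: pos_law_def intro: prob_spaceI)
qed

text \<open>A Poisson mixture produces the exponent m(q - 1); here it is identified with the Levy
  integral over \<open>W\<close>. The bound \<open>C\<close> covers both uses: \<open>W\<close>
  inside [0,1] with any s, and W = (1,\<infinity>) with s \<le> 0.\<close>

lemma nn_integral_exp_normalized:
  assumes nu: "sets \<nu> = sets borel" and W [measurable]: "W \<in> sets borel"
    and nonneg: "W \<subseteq> {0..}" and fin: "emeasure \<nu> W < \<infinity>" and pos: "0 < measure \<nu> W"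
    and bd: "\<And>x. x \<in> W \<Longrightarrow> exp (s * x) \<le> C"
  shows "\<exists>q\<ge>0. (\<integral>\<^sup>+x. exp (s * x) \<partial>normalized \<nu> W) = ennreal q \<and>
      integrable \<nu> (\<lambda>x. indicator W x * (exp (s * x) - 1)) \<and>
      measure \<nu> W * (q - 1) = (\<integral>x. indicator W x * (exp (s * x) - 1) \<partial>\<nu>)"
proof -
  note [measurable_cong] = nu
  let ?m = "measure \<nu> W"
  have intW: "integrable \<nu> (indicator W :: real \<Rightarrow> real)"
    using W nu fin by (intro integrable_real_indicator) auto
  have int: "integrable \<nu> (\<lambda>x. indicator W x * exp (s * x))"
    by (rule Bochner_Integration.integrable_bound[of _ "\<lambda>x. C * indicator W x"])
      (auto intro!: intW bd split: split_indicator intro: order_trans[OF bd abs_ge_self])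
  define q where "q = (\<integral>x. indicator W x * exp (s * x) \<partial>\<nu>) / ?m"
  have q: "0 \<le> q" by (simp add: q_def)
  have "(\<integral>\<^sup>+x. exp (s * x) \<partial>normalized \<nu> W) = (\<integral>\<^sup>+x. ennreal (exp (s * x)) * indicator W x \<partial>\<nu>) / ennreal ?m"
    by (rule nn_integral_normalized[OF nu W nonneg fin pos]) measurable
  also have "(\<integral>\<^sup>+x. ennreal (exp (s * x)) * indicator W x \<partial>\<nu>) = (\<integral>\<^sup>+x. ennreal (indicator W x * exp (s * x)) \<partial>\<nu>)"
    by (intro nn_integral_cong) (auto split: split_indicator)
  also have "\<dots> = ennreal (\<integral>x. indicator W x * exp (s * x) \<partial>\<nu>)"
    by (rule nn_integral_eq_integral[OF int]) auto
  also have "\<dots> / ennreal ?m = ennreal q"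
    unfolding q_def by (rule divide_ennreal) (auto simp: pos)
  finally have 1: "(\<integral>\<^sup>+x. exp (s * x) \<partial>normalized \<nu> W) = ennreal q" .
  have "(\<integral>x. indicator W x * exp (s * x) - indicator W x \<partial>\<nu>) =
      (\<integral>x. indicator W x * exp (s * x) \<partial>\<nu>) - (\<integral>x. indicator W x \<partial>\<nu>)"
    by (rule Bochner_Integration.integral_diff[OF int intW])
  also have "\<dots> = ?m * q - ?m" using pos W nu sets_eq_imp_space_eq[OF nu] by (simp add: q_def)
  finally have 2: "?m * (q - 1) = (\<integral>x. indicator W x * (exp (s * x) - 1) \<partial>\<nu>)"
    by (simp add: right_diff_distrib)
  have "integrable \<nu> (\<lambda>x. indicator W x * exp (s * x) - indicator W x)"
    by (rule Bochner_Integration.integrable_diff[OF int intW])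
  with q 1 2 show ?thesis by (auto simp: right_diff_distrib)
qed

lemma compound_poisson_exists:
  assumes nu: "sets \<nu> = sets borel" and W [measurable]: "W \<in> sets borel"
    and W01: "W \<subseteq> {0..1}" and fin: "emeasure \<nu> W < \<infinity>" and a: "0 \<le> a"
  shows "\<exists>P. pos_law P \<and> (\<forall>s. (\<integral>\<^sup>+x. exp (s * x) \<partial>P) =
    ennreal (exp (s * a + (\<integral>x. indicator W x * (exp (s * x) - 1) \<partial>\<nu>))))"
proof -
  let ?B = "return borel a"
  have B: "pos_law ?B"
    using a by (auto simp: pos_law_def AE_return prob_space_return)
  have nB: "(\<integral>\<^sup>+x. exp (s * x) \<partial>?B) = ennreal (exp (s * a))" for s
    by (subst nn_integral_return) auto
  show ?thesis
  proof (cases "measure \<nu> W = 0")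
    case True
    \<comment> \<open>A null set of jumps cannot be normalised; the drift alone is then the required
      law.\<close>
    have "emeasure \<nu> W = 0" using True fin by (simp add: emeasure_eq_ennreal_measure)
    then have "AE x in \<nu>. x \<notin> W" using W nu by (intro AE_not_in) (auto simp: null_sets_def)
    then have "(\<integral>x. indicator W x * (exp (s * x) - 1) \<partial>\<nu>) = 0" for s
      by (intro integral_eq_zero_AE) (auto split: split_indicator elim: eventually_mono)
    with B nB show ?thesis by (intro exI[of _ ?B]) auto
  next
    case False
    then have pos: "0 < measure \<nu> W" by (simp add: zero_less_measure_iff)
    have W0: "W \<subseteq> {0..}" using W01 by auto
    let ?Q = "normalized \<nu> W"
    have Q: "pos_law ?Q" by (rule pos_law_normalized[OF nu W W0 fin pos])
    have "(\<integral>\<^sup>+x. exp (s * x) \<partial>poisson_mix (measure \<nu> W) ?B ?Q) =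
      ennreal (exp (s * a + (\<integral>x. indicator W x * (exp (s * x) - 1) \<partial>\<nu>)))" for s
    proof -
      have "exp (s * x) \<le> exp \<bar>s\<bar>" if "x \<in> W" for x
      proof -
        have "s * x \<le> \<bar>s\<bar> * 1" using W01 that by (intro mult_mono) auto
        then show ?thesis by simp
      qed
      from nn_integral_exp_normalized[OF nu W W0 fin pos this] obtain q where q: "0 \<le> q"
        "(\<integral>\<^sup>+x. exp (s * x) \<partial>?Q) = ennreal q"
        "measure \<nu> W * (q - 1) = (\<integral>x. indicator W x * (exp (s * x) - 1) \<partial>\<nu>)" by blast
      have "(\<integral>\<^sup>+x. exp (s * x) \<partial>poisson_mix (measure \<nu> W) ?B ?Q) =
          ennreal (exp (s * a) * exp (measure \<nu> W * (q - 1)))"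
        by (rule nn_integral_exp_poisson_mix[OF pos B Q _ q(1) nB q(2)]) simp
      then show ?thesis by (simp add: q(3) exp_add)
    qed
    with pos_law_poisson_mix[OF pos B Q] show ?thesis by blast
  qed
qed

text \<open>Linear in y near 0, which turns integrability of x on (0,1] into integrability of the
  Levy exponent.\<close>

lemma abs_exp_minus_1_le: "\<bar>exp y - 1\<bar> \<le> \<bar>y\<bar> * exp \<bar>y\<bar>" for y :: real
proof (cases "0 \<le> y")
  case True
  have "(1 - y) * exp y \<le> exp (- y) * exp y"
    using exp_ge_add_one_self[of "- y"] by (intro mult_right_mono) auto
  then have "exp y - 1 \<le> y * exp y" by (simp add: mult_exp_exp algebra_simps)
  with True show ?thesis by simp
next
  case False
  then have "\<bar>exp y - 1\<bar> = 1 - exp y" "\<bar>y\<bar> = - y" by auto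
  then have "\<bar>exp y - 1\<bar> \<le> \<bar>y\<bar> * 1" using exp_ge_add_one_self[of y] by linarith
  also have "\<dots> \<le> \<bar>y\<bar> * exp \<bar>y\<bar>" by (intro mult_left_mono) auto
  finally show ?thesis .
qed

text \<open>The Levy measure may be infinite near 0, so jumps are first cut off below 1 / (k + 1),
  where finiteness of the integral of x bounds their mass. The exponents then converge by
  domination, the dominating function being a multiple of x on (0,1].\<close>

lemma small_jump_law_exists:
  fixes a :: real
  assumes nu: "sets \<nu> = sets borel" and a: "0 \<le> a"
    and nu_int: "(\<integral>\<^sup>+x. ennreal x * indicator {0<..1} x \<partial>\<nu>) < \<infinity>"
  obtains P K where "pos_law P"
    "\<And>l. integrable \<nu> (\<lambda>x. indicator {0<..1} x * (exp (- l * x) - 1))"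
    "\<And>l. 0 \<le> l \<Longrightarrow> (\<integral>x. exp (- l * x) \<partial>P) = exp (- l * a + (\<integral>x. indicator {0<..1} x * (exp (- l * x) - 1) \<partial>\<nu>))"
    "\<And>x. measure P {x<..} \<le> K * exp (- 2 * x)"
proof -
  note [measurable_cong] = nu
  define W where "W k = {1 / real (Suc k)<..1}" for k
  define \<psi> where "\<psi> V s = (\<integral>x. indicator V x * (exp (s * x) - 1) \<partial>\<nu>)" for V s
  have W [measurable]: "W k \<in> sets borel" for k by (simp add: W_def)
  have W01: "W k \<subseteq> {0<..1}" for k
  proof
    fix x assume x: "x \<in> W k"
    have "0 < 1 / real (Suc k)" by simp
    also have "1 / real (Suc k) < x" using x by (simp add: W_def)
    finally show "x \<in> {0<..1}" using x by (simp add: W_def)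
  qed
  have intx: "integrable \<nu> (\<lambda>x. x * indicator {0<..1} x)"
  proof (rule integrableI_bounded)
    have "(\<integral>\<^sup>+x. ennreal (norm (x * indicator {0<..1} x)) \<partial>\<nu>) = (\<integral>\<^sup>+x. ennreal x * indicator {0<..1} x \<partial>\<nu>)"
      by (intro nn_integral_cong) (auto split: split_indicator)
    with nu_int show "(\<integral>\<^sup>+x. ennreal (norm (x * indicator {0<..1} x)) \<partial>\<nu>) < \<infinity>" by simp
  qed measurable
  have bound: "norm (indicator V x * (exp (s * x) - 1)) \<le> \<bar>s\<bar> * exp \<bar>s\<bar> * (x * indicator {0<..1} x)"
    if "V \<subseteq> {0<..1}" for V s x
  proof (cases "x \<in> V")
    case True
    then have x: "0 < x" "x \<le> 1" using that by auto
    have "\<bar>exp (s * x) - 1\<bar> \<le> \<bar>s * x\<bar> * exp \<bar>s * x\<bar>" by (rule abs_exp_minus_1_le)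
    also have "\<dots> \<le> \<bar>s * x\<bar> * exp \<bar>s\<bar>"
      using x by (intro mult_left_mono) (auto simp: abs_mult mult_left_le)
    finally show ?thesis using True x that by (auto simp: abs_mult mult_ac)
  qed (auto split: split_indicator)
  have int: "integrable \<nu> (\<lambda>x. indicator V x * (exp (s * x) - 1))"
    if "V \<subseteq> {0<..1}" and [measurable]: "V \<in> sets borel" for V s
  proof (rule Bochner_Integration.integrable_bound)
    show "integrable \<nu> (\<lambda>x. \<bar>s\<bar> * exp \<bar>s\<bar> * (x * indicator {0<..1} x))"
      by (intro integrable_mult_right intx)
    show "AE x in \<nu>. norm (indicator V x * (exp (s * x) - 1)) \<le> norm (\<bar>s\<bar> * exp \<bar>s\<bar> * (x * indicator {0<..1} x))"
      using bound[OF that(1)] by (intro AE_I2 order_trans[OF bound[OF that(1)]]) auto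
  qed measurable
  have fin: "emeasure \<nu> (W k) < \<infinity>" for k
  proof -
    have "emeasure \<nu> (W k) = (\<integral>\<^sup>+x. indicator (W k) x \<partial>\<nu>)" using W nu by simp
    also have "\<dots> \<le> (\<integral>\<^sup>+x. ennreal (Suc k) * (ennreal x * indicator {0<..1} x) \<partial>\<nu>)"
    proof (rule nn_integral_mono)
      fix x
      show "indicator (W k) x \<le> ennreal (Suc k) * (ennreal x * indicator {0<..1} x)"
      proof (cases "x \<in> W k")
        case True
        then have "1 / real (Suc k) < x" by (simp add: W_def)
        then have "1 \<le> real (Suc k) * x" by (simp add: field_simps)
        moreover have "0 < x" "x \<le> 1" using True W01[of k] by auto
        ultimately show ?thesis using True by (simp add: ennreal_mult[symmetric] del: of_nat_Suc)
      qed simp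
    qed
    also have "\<dots> = ennreal (Suc k) * (\<integral>\<^sup>+x. ennreal x * indicator {0<..1} x \<partial>\<nu>)"
      by (rule nn_integral_cmult) measurable
    also have "\<dots> < \<infinity>" using nu_int by (simp add: ennreal_mult_less_top del: of_nat_Suc)
    finally show ?thesis .
  qed
  have "\<exists>P. pos_law P \<and> (\<forall>s. (\<integral>\<^sup>+x. exp (s * x) \<partial>P) = ennreal (exp (s * a + \<psi> (W k) s)))" for k
    unfolding \<psi>_def using W01[of k] by (intro compound_poisson_exists[OF nu W _ fin a]) auto
  then obtain M where M: "\<And>k. pos_law (M k)"
    and exp_M: "\<And>k s. (\<integral>\<^sup>+x. exp (s * x) \<partial>M k) = ennreal (exp (s * a + \<psi> (W k) s))" by metis
  \<comment> \<open>The moment at s = 2 with all jumps in (0,1] present. As exp(2x) - 1 is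
    nonnegative there, truncation only lowers the exponent, and \<open>K\<close> works for every
    k.\<close>
  define K where "K = exp (2 * a + \<psi> {0<..1} 2)"
  have "(\<lambda>k. \<psi> (W k) s) \<longlonglongrightarrow> \<psi> {0<..1} s" for s
    unfolding \<psi>_def
  proof (rule integral_dominated_convergence)
    show "integrable \<nu> (\<lambda>x. \<bar>s\<bar> * exp \<bar>s\<bar> * (x * indicator {0<..1} x))"
      by (intro integrable_mult_right intx)
    show "AE x in \<nu>. (\<lambda>k. indicator (W k) x * (exp (s * x) - 1)) \<longlonglongrightarrow> indicator {0<..1} x * (exp (s * x) - 1)"
    proof (intro AE_I2 tendsto_mult tendsto_const)
      fix x :: real
      show "(\<lambda>k. indicator (W k) x :: real) \<longlonglongrightarrow> indicator {0<..1} x"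
      proof (rule tendsto_eventually)
        show "\<forall>\<^sub>F k in sequentially. (indicator (W k) x :: real) = indicator {0<..1} x"
        proof (cases "x \<in> {0<..1}")
          case True
          then have "\<forall>\<^sub>F k in sequentially. 1 / real (Suc k) < x"
            using LIMSEQ_inverse_real_of_nat by (intro order_tendstoD(2)) (auto simp: inverse_eq_divide)
          then show ?thesis by eventually_elim (use True in \<open>auto simp: W_def\<close>)
        next
          case False
          then have "x \<notin> W k" for k using W01[of k] by blast
          then show ?thesis using False by simp
        qed
      qed
    qed
  qed (use bound W01 in auto)
  note \<psi>_lim = this
  have \<psi>_mono: "\<psi> (W k) 2 \<le> \<psi> {0<..1} 2" for k
    unfolding \<psi>_def
    by (intro integral_mono int W01) (use W01[of k] in \<open>auto simp: indicator_def\<close>)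
  have mom: "(\<integral>\<^sup>+y. exp (2 * y) \<partial>M k) \<le> ennreal K" for k
    unfolding exp_M K_def using \<psi>_mono by (intro ennreal_leI) simp
  have lap: "(\<integral>x. exp (- l * x) \<partial>M k) = exp (- l * a + \<psi> (W k) (- l))" for l k
  proof -
    note [measurable_cong] = pos_lawD(2)[OF M]
    have "(\<integral>x. exp (- l * x) \<partial>M k) = enn2real (\<integral>\<^sup>+x. exp (- l * x) \<partial>M k)"
      by (rule integral_eq_nn_integral) auto
    then show ?thesis unfolding exp_M by simp
  qed
  have lim: "(\<lambda>k. \<integral>x. exp (- l * x) \<partial>M k) \<longlonglongrightarrow> exp (- l * a + \<psi> {0<..1} (- l))" for l
    unfolding lap by (intro tendsto_intros \<psi>_lim)
  obtain P where P: "pos_law P" "\<And>l. 0 \<le> l \<Longrightarrow> (\<integral>x. exp (- l * x) \<partial>P) = exp (- l * a + \<psi> {0<..1} (- l))"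
    "\<And>x. measure P {x<..} \<le> K * exp (- 2 * x)"
    using pos_law_weak_limit[OF M _ mom lim] by (auto simp: K_def)
  show ?thesis
    using that[OF P(1) _ P(2)[unfolded \<psi>_def] P(3)] int[of "{0<..1}" "- _"] by simp
qed

text \<open>Both laws have the same Laplace transform at every integer: splitting the Levy exponent
  at jump size 1 matches the factor of \<open>B\<close> and the factor of the Poisson
  mixture.\<close>

lemma infinitely_divisible_decomposition:
  fixes a \<mu> :: real
  assumes F: "pos_law F" and nu: "sets \<nu> = sets borel" and nu_supp: "emeasure \<nu> {..0} = 0"
    and a: "0 \<le> a" and mu_fin: "emeasure \<nu> {1<..} < \<infinity>"
    and mu_def: "\<mu> = measure \<nu> {1<..}" and mu_pos: "0 < \<mu>"
    and nu_int: "(\<integral>\<^sup>+x. ennreal x * indicator {0<..1} x \<partial>\<nu>) < \<infinity>"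
    and laplace: "\<And>l. 0 \<le> l \<Longrightarrow> (\<integral>x. exp (- l * x) \<partial>F) = exp (- a * l - (\<integral>x. (1 - exp (- l * x)) \<partial>\<nu>))"
  obtains B K where "pos_law B" "\<And>x. measure B {x<..} \<le> K * exp (- 2 * x)"
    "F = poisson_mix \<mu> B (normalized \<nu> {1<..})"
proof -
  note [measurable_cong] = nu
  obtain B K where B: "pos_law B"
    "\<And>l. integrable \<nu> (\<lambda>x. indicator {0<..1} x * (exp (- l * x) - 1))"
    "\<And>l. 0 \<le> l \<Longrightarrow> (\<integral>x. exp (- l * x) \<partial>B) = exp (- l * a + (\<integral>x. indicator {0<..1} x * (exp (- l * x) - 1) \<partial>\<nu>))"
    "\<And>x. measure B {x<..} \<le> K * exp (- 2 * x)"
    by (rule small_jump_law_exists[OF nu a nu_int]) (rule that; assumption)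
  let ?G = "normalized \<nu> {1<..}"
  have pos: "0 < measure \<nu> {1<..}" using mu_pos mu_def by simp
  have G: "pos_law ?G" by (rule pos_law_normalized[OF nu _ _ mu_fin pos]) auto
  have mix: "pos_law (poisson_mix \<mu> B ?G)" by (rule pos_law_poisson_mix[OF mu_pos B(1) G])
  have "F = poisson_mix \<mu> B ?G"
  proof (rule laplace_unique[OF F mix])
    fix n :: nat
    let ?l = "real n"
    let ?b = "exp (- ?l * a + (\<integral>x. indicator {0<..1} x * (exp (- ?l * x) - 1) \<partial>\<nu>))"
    have "exp (- ?l * x) \<le> 1" if "x \<in> {1<..}" for x using that by simp
    from nn_integral_exp_normalized[OF nu _ _ mu_fin pos this] obtain q where q: "0 \<le> q"
      "(\<integral>\<^sup>+x. exp (- ?l * x) \<partial>?G) = ennreal q"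
      "integrable \<nu> (\<lambda>x. indicator {1<..} x * (exp (- ?l * x) - 1))"
      "\<mu> * (q - 1) = (\<integral>x. indicator {1<..} x * (exp (- ?l * x) - 1) \<partial>\<nu>)"
      unfolding mu_def by fastforce
    have nB: "(\<integral>\<^sup>+x. exp (- ?l * x) \<partial>B) = ennreal ?b"
    proof -
      interpret B: prob_space B by (rule pos_lawD[OF B(1)])
      note [measurable_cong] = pos_lawD(2)[OF B(1)]
      have "integrable B (\<lambda>x. exp (- ?l * x))"
        by (rule B.integrable_const_bound[of _ 1], use pos_lawD(3)[OF B(1)] in eventually_elim) auto
      then show ?thesis
        using B(3)[of ?l] by (subst nn_integral_eq_integral) auto
    qed
    have "(\<integral>\<^sup>+x. exp (- ?l * x) \<partial>poisson_mix \<mu> B ?G) = ennreal (?b * exp (\<mu> * (q - 1)))"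
      by (rule nn_integral_exp_poisson_mix[OF mu_pos B(1) G _ q(1) nB q(2)]) simp
    then have "(\<integral>x. exp (- ?l * x) \<partial>poisson_mix \<mu> B ?G) = ?b * exp (\<mu> * (q - 1))"
      using pos_lawD(2)[OF mix] by (subst integral_eq_nn_integral) auto
    also have "\<dots> = exp (- a * ?l - (\<integral>x. (1 - exp (- ?l * x)) \<partial>\<nu>))"
    proof -
      \<comment> \<open>Outside this null set the two indicators add up to 1. Both pieces are
        integrable, so the integral in the hypothesis is a genuine one and not the default value
        0.\<close>
      have "AE x in \<nu>. x \<notin> {..0}"
        using nu nu_supp by (intro AE_not_in) (auto simp: null_sets_def)
      then have "(\<integral>x. (1 - exp (- ?l * x)) \<partial>\<nu>) =
          (\<integral>x. - (indicator {0<..1} x * (exp (- ?l * x) - 1) + indicator {1<..} x * (exp (- ?l * x) - 1)) \<partial>\<nu>)"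
        by (intro integral_cong_AE) (auto elim!: eventually_mono simp: indicator_def)
      also have "\<dots> = - ((\<integral>x. indicator {0<..1} x * (exp (- ?l * x) - 1) \<partial>\<nu>) + \<mu> * (q - 1))"
        unfolding q(4) by (subst Bochner_Integration.integral_minus, subst Bochner_Integration.integral_add)
          (auto intro: B(2)[of ?l, simplified] q(3)[simplified])
      finally have eq: "(\<integral>x. (1 - exp (- ?l * x)) \<partial>\<nu>) =
          - ((\<integral>x. indicator {0<..1} x * (exp (- ?l * x) - 1) \<partial>\<nu>) + \<mu> * (q - 1))" .
      show ?thesis unfolding eq mult_exp_exp by (simp add: algebra_simps)
    qed
    finally show "(\<integral>x. exp (- real n * x) \<partial>F) = (\<integral>x. exp (- real n * x) \<partial>poisson_mix \<mu> B ?G)"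
      using laplace[of ?l] by simp
  qed
  with B(1,4) show ?thesis using that by blast
qed
subsection \<open>The equivalence\<close>

text \<open>Asymptotic equivalence reads 0/0 as 1; eventual positivity of \<open>d\<close> reduces
  it to an ordinary quotient. Symmetry is used first because \<open>f\<close>, known to be c times
  \<open>d\<close>, belongs in the denominator.\<close>

lemma asymp_equiv_iff_ratio_tendsto:
  fixes f g d :: "real \<Rightarrow> real"
  assumes c: "0 < c" and d: "\<forall>\<^sub>F x in at_top. 0 < d x" and f: "\<forall>\<^sub>F x in at_top. f x = c * d x"
  shows "f \<sim>[at_top] g \<longleftrightarrow> ((\<lambda>x. g x / d x) \<longlongrightarrow> c) at_top"
proof -
  have "f \<sim>[at_top] g \<longleftrightarrow> g \<sim>[at_top] f" by (rule asymp_equiv_sym)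
  also have "\<dots> \<longleftrightarrow> ((\<lambda>x. g x / d x / c) \<longlongrightarrow> 1) at_top"
    unfolding asymp_equiv_def
    by (rule tendsto_cong, use d f in eventually_elim) (use c in \<open>auto simp: field_simps\<close>)
  also have "\<dots> \<longleftrightarrow> ((\<lambda>x. g x / d x) \<longlongrightarrow> c) at_top"
    using c tendsto_mult_right_iff[of c "\<lambda>x. g x / d x / c" 1 at_top] by simp
  finally show ?thesis .
qed

section \<open>Tail comparisons for the converse with an infinite window\<close>

context window
begin

lemma slab_le_D:
  assumes "pos_law A" "pos_law B" "W \<in> sets borel"
  shows "slab A B W x \<le> D (A \<star> B) x"
proof -
  have "slab A B (W \<union> - W) x = slab A B W x + slab A B (- W) x"
    using assms by (intro slab_Un) auto
  moreover have "0 \<le> slab A B (- W) x" by (simp add: slab_def)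
  ultimately show ?thesis using slab_UNIV[OF assms(1,2), of x] by (simp add: Compl_partition)
qed

text \<open>Each of the n jumps exceeds 1 and the initial part is nonnegative. This yields positive
  tails for F while nothing is yet known about the tail of G.\<close>

lemma conv_iter_tail_infinite:
  assumes T: "T = \<infinity>" and B: "pos_law B" and G: "pos_law G" and G1: "measure G {1<..} = 1"
    and "x < real n"
  shows "D (conv_iter B G n) x = 1"
  using assms(5)
proof (induction n arbitrary: x)
  case 0
  then show ?case using D_negative_infinite[OF T B] by simp
next
  case (Suc n)
  have H: "pos_law (conv_iter B G n)" by (rule pos_law_conv_iter[OF B G])
  have "1 * measure G {1<..} \<le> slab (conv_iter B G n) G {1<..} x"
    using Suc by (intro slab_ge[OF H G]) auto
  also have "\<dots> \<le> D (conv_iter B G (Suc n)) x"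
    unfolding conv_iter.simps by (intro slab_le_D H G) simp
  finally show ?case
    using G1 prob_space.prob_le_1[OF pos_lawD(1)[OF pos_law_conv_iter[OF B G, of "Suc n"]]]
    by (intro antisym) auto
qed

text \<open>A nonnegative summand can only raise a tail probability. For a bounded window it could
  also carry the sum past the right end.\<close>

lemma D_le_convolution_infinite:
  assumes T: "T = \<infinity>" and A: "pos_law A" and G: "pos_law G"
  shows "D G x \<le> D (A \<star> G) x"
proof -
  interpret A: prob_space A by (rule pos_lawD[OF A])
  interpret G: prob_space G by (rule pos_lawD[OF G])
  have "D G x * measure A UNIV \<le> slab G A UNIV x"
    by (rule slab_ge[OF G A]) (auto intro!: D_antimono_infinite[OF T G])
  moreover have "measure A UNIV = 1" using A.prob_space pos_lawD(4)[OF A] by simp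
  moreover have "slab G A UNIV x = D (A \<star> G) x"
    using slab_UNIV[OF G A] pos_lawD(2)[OF A] pos_lawD(2)[OF G]
    by (simp add: convolution_commutative A.finite_measure_axioms G.finite_measure_axioms)
  ultimately show ?thesis by simp
qed

end

theorem theorem7:
  fixes F \<nu> G :: "real measure" and a \<mu> :: real and T :: ereal
  assumes F_prob: "prob_space F" and F_sets: "sets F = sets borel"
    and F_supp: "emeasure F {..<0} = 0"
    and F_id: "infinitely_divisible F"
    and a_nonneg: "a \<ge> 0"
    and nu_sets: "sets \<nu> = sets borel"
    and nu_supp: "emeasure \<nu> {..0} = 0"
    and mu_fin: "emeasure \<nu> {1<..} < \<infinity>"
    and mu_def: "\<mu> = measure \<nu> {1<..}"
    and mu_pos: "\<mu> > 0"
    and nu_int: "(\<integral>\<^sup>+ x. ennreal x * indicator {0<..1} x \<partial>\<nu>) < \<infinity>"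
    and laplace: "\<And>l. l \<ge> 0 \<Longrightarrow>
        (\<integral>x. exp (- l * x) \<partial>F) = exp (- a * l - (\<integral>x. (1 - exp (- l * x)) \<partial>\<nu>))"
    and G_sets: "sets G = sets borel"
    and G_def: "\<And>B. B \<in> sets borel \<Longrightarrow> emeasure G B = emeasure \<nu> (B \<inter> {1<..}) / ennreal \<mu>"
    and T_pos: "T > 0"
    and G_L: "T < \<infinity> \<Longrightarrow> L_Delta T G"
  shows "S_Delta T G \<longleftrightarrow>
    (\<lambda>x. measure \<nu> (shift_int T x)) \<sim>[at_top] (\<lambda>x. measure F (shift_int T x))"
proof -
  interpret window T by unfold_locales (rule T_pos)
  have F: "pos_law F"
  proof -
    have "{..<0} \<in> null_sets F" using F_supp F_sets by (simp add: null_sets_def)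
    from AE_not_in[OF this] have "AE x in F. 0 \<le> x" by eventually_elim simp
    then show ?thesis using F_prob F_sets by (simp add: pos_law_def)
  qed
  have nu_pos: "0 < measure \<nu> {1<..}" using mu_pos mu_def by simp
  have "G = normalized \<nu> {1<..}"
  proof (rule measure_eqI)
    fix S assume "S \<in> sets G"
    then have S [measurable]: "S \<in> sets borel" using G_sets by simp
    have "emeasure (normalized \<nu> {1<..}) S = (\<integral>\<^sup>+x. indicator S x \<partial>normalized \<nu> {1<..})"
      using nu_sets by (subst nn_integral_indicator) (auto simp: normalized_def)
    also have "\<dots> = (\<integral>\<^sup>+x. indicator S x * indicator {1<..} x \<partial>\<nu>) / ennreal \<mu>"
      unfolding mu_def by (rule nn_integral_normalized[OF nu_sets _ _ mu_fin nu_pos]) auto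
    also have "(\<integral>\<^sup>+x. indicator S x * indicator {1<..} x \<partial>\<nu>) = (\<integral>\<^sup>+x. indicator (S \<inter> {1<..}) x \<partial>\<nu>)"
      by (intro nn_integral_cong) (auto split: split_indicator)
    also have "\<dots> = emeasure \<nu> (S \<inter> {1<..})"
      using nu_sets by (intro nn_integral_indicator) auto
    finally show "emeasure G S = emeasure (normalized \<nu> {1<..}) S" by (simp add: G_def)
  qed (simp add: G_sets normalized_def nu_sets)
  then obtain B K where B: "pos_law B" and B_tail: "\<And>x. measure B {x<..} \<le> K * exp (- 2 * x)"
    and F_mix: "F = poisson_mix \<mu> B G"
    using infinitely_divisible_decomposition[OF F nu_sets nu_supp a_nonneg mu_fin mu_def mu_pos nu_int laplace]
    by metis
  have G: "pos_law G"
    unfolding \<open>G = _\<close> by (rule pos_law_normalized[OF nu_sets _ _ mu_fin nu_pos]) auto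
  interpret G: prob_space G by (rule pos_lawD[OF G])
  define H where "H = conv_iter B G"
  have H: "pos_law (H n)" for n unfolding H_def by (rule pos_law_conv_iter[OF B G])
  have w: "0 < poisson_weight \<mu> n" for n by (rule poisson_weight_pos[OF mu_pos])
  have F_sums: "(\<lambda>n. poisson_weight \<mu> n * D (H n) x) sums D F x" for x
    unfolding F_mix H_def by (rule measure_poisson_mix_sums[OF mu_pos B G shift_int_sets])
  \<comment> \<open>From x = 1 on the window lies inside (1,\<infinity>), where \<nu> is \<mu> times
    G.\<close>
  have nu_D: "measure \<nu> (shift_int T x) = \<mu> * D G x" if "1 \<le> x" for x
  proof -
    have "shift_int T x \<inter> {1<..} = shift_int T x" using that by (auto dest: shift_int_gt)
    then have "ennreal (D G x) = emeasure \<nu> (shift_int T x) / ennreal \<mu>"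
      using G_def[OF shift_int_sets] by (simp add: G.emeasure_eq_measure)
    moreover have "emeasure \<nu> (shift_int T x) < \<infinity>"
      using mu_fin that nu_sets
      by (intro le_less_trans[OF emeasure_mono mu_fin]) (auto dest: shift_int_gt)
    ultimately have "ennreal (D G x) = ennreal (measure \<nu> (shift_int T x) / \<mu>)"
      using mu_pos by (simp add: emeasure_eq_ennreal_measure divide_ennreal)
    then show ?thesis using mu_pos by (simp add: field_simps)
  qed
  then have nu_D': "\<forall>\<^sub>F x in at_top. measure \<nu> (shift_int T x) = \<mu> * D G x"
    unfolding eventually_at_top_linorder by blast
  have main_iff: "(\<lambda>x. measure \<nu> (shift_int T x)) \<sim>[at_top] (\<lambda>x. D F x) \<longleftrightarrow>
      ((\<lambda>x. D F x / D G x) \<longlongrightarrow> \<mu>) at_top" if "\<forall>\<^sub>F x in at_top. 0 < D G x"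
    by (rule asymp_equiv_iff_ratio_tendsto[OF mu_pos that nu_D'])
  have sub_iff: "(\<lambda>x. D (G \<star> G) x) \<sim>[at_top] (\<lambda>x. 2 * D G x) \<longleftrightarrow>
      ((\<lambda>x. D (G \<star> G) x / D G x) \<longlongrightarrow> 2) at_top" if "\<forall>\<^sub>F x in at_top. 0 < D G x"
    by (subst asymp_equiv_sym, rule asymp_equiv_iff_ratio_tendsto[OF _ that]) auto
  show ?thesis
  proof
    assume S: "S_Delta T G"
    interpret long_tailed_law T G
      using S G by unfold_locales (simp_all add: S_Delta_def)
    have GG: "minorizes G (G \<star> G) 2" "majorizes G (G \<star> G) 2"
      using S sub_iff[OF D_pos] tendsto_ratio_iff[OF D_pos, of 2] by (simp_all add: S_Delta_def)
    have mid: "mid_negligible G G"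
      using mid_negligibleI[OF G _ minorizes_refl] GG(2) by simp
    have B0: "majorizes G B 0" by (rule light_tail_majorizes[OF B B_tail])
    have lim: "((\<lambda>x. D (H n) x / D G x) \<longlongrightarrow> real n) at_top" for n
      unfolding H_def using minorizes_conv_iter[OF B] majorizes_conv_iter[OF B B0 mid]
      by (subst tendsto_ratio_iff[OF D_pos]) auto
    obtain x1 M where bound: "\<And>x n. x1 \<le> x \<Longrightarrow> 0 < D G x \<and> D (H n) x \<le> M ^ n * D G x"
      unfolding H_def using conv_iter_geometric_bound[OF B B0 GG(2)] by blast
    have "((\<lambda>x. D F x / D G x) \<longlongrightarrow> \<mu>) at_top"
      using mixture_ratio_tendsto[OF F_sums w poisson_weight_mean_sums lim bound]
        sums_summable[OF poisson_weight_power_sums] by blast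
    then show "(\<lambda>x. measure \<nu> (shift_int T x)) \<sim>[at_top] (\<lambda>x. measure F (shift_int T x))"
      using main_iff[OF D_pos] by simp
  next
    assume asymp: "(\<lambda>x. measure \<nu> (shift_int T x)) \<sim>[at_top] (\<lambda>x. measure F (shift_int T x))"
    \<comment> \<open>Stated conditionally because positivity and the lower bounds come from
      long-tailedness when \<open>T\<close> is finite and from monotone tails when it is
      infinite.\<close>
    have H2: "majorizes G (H 2) 2"
      if "\<forall>\<^sub>F x in at_top. 0 < D G x" "\<And>n. minorizes G (H n) (real n)"
    proof -
      have "majorizes G F \<mu>"
        using asymp main_iff[OF that(1)] tendsto_ratio_iff[OF that(1), of \<mu> F] mu_pos by simp
      from mixture_component_majorizes[OF F_sums w poisson_weight_mean_sums that(2) this, of 2]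
      show ?thesis by simp
    qed
    have concl: "S_Delta T G"
      if "L_Delta T G" "majorizes G (G \<star> G) 2"
    proof -
      interpret long_tailed_law T G using that G by unfold_locales
      have "minorizes G (G \<star> G) 2"
        using minorizes_convolution[OF G _ minorizes_refl] by simp
      then have "(\<lambda>x. D (G \<star> G) x) \<sim>[at_top] (\<lambda>x. 2 * D G x)"
        using sub_iff[OF D_pos] tendsto_ratio_iff[OF D_pos, of 2] that(2) by simp
      moreover have "0 < measure G {x<..}" for x
      proof -
        have "\<forall>\<^sub>F y in at_top. 0 < D G y \<and> x \<le> y"
          using D_pos eventually_ge_at_top[of x] by eventually_elim simp
        from eventually_happens[OF this] obtain y where y: "0 < D G y" "x \<le> y" by auto
        have "D G y \<le> measure G {x<..}"
          using y(2) G_sets by (intro G.finite_measure_mono) (auto dest: shift_int_gt)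
        with y(1) show ?thesis by simp
      qed
      moreover have "emeasure G {..<0} = 0"
      proof -
        have "{..<0} \<inter> {1<..} = ({} :: real set)" by auto
        then show ?thesis using G_def[of "{..<0}"] by simp
      qed
      ultimately show ?thesis
        using that(1) G_sets G.prob_space_axioms by (simp add: S_Delta_def)
    qed
    show "S_Delta T G"
    proof (cases "T = \<infinity>")
      case False
      then have L: "L_Delta T G" using G_L by (cases T) auto
      interpret long_tailed_law T G using L G by unfold_locales
      have min: "minorizes G (H n) (real n)" for n
        unfolding H_def by (rule minorizes_conv_iter[OF B])
      \<comment> \<open>The upper bound for H_2 is thus the hypothesis of
        \<open>mid_negligibleI\<close> with A = H_1 and c = 1.\<close>
      have "H 2 = (H 1 \<star> G)" by (simp add: H_def numeral_2_eq_2)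
      then have "mid_negligible (H 1) G"
        using mid_negligibleI[OF H, of 1 1] min[of 1] H2[OF D_pos min] by simp
      then have "mid_negligible G G"
        using mid_negligible_transfer[OF H, of 1] min[of 1] by simp
      then have "majorizes G (G \<star> G) 2"
        using majorizes_convolution[OF G _ majorizes_refl] by simp
      with L show ?thesis by (rule concl)
    next
      case True
      have G1: "measure G {1<..} = 1"
      proof -
        have "emeasure G {1<..} = emeasure G UNIV"
          using G_def[of "{1<..}"] G_def[of UNIV] by simp
        then show ?thesis
          using G.emeasure_space_1 pos_lawD(4)[OF G] by (simp add: measure_def)
      qed
      have F_pos: "0 < D F x" for x
      proof -
        obtain n where n: "x < real n" using reals_Archimedean2 by blast
        have "0 < poisson_weight \<mu> n * D (H n) x"
          using w[of n] conv_iter_tail_infinite[OF True B G G1 n] by (simp add: H_def)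
        also have "\<dots> \<le> D F x"
          using sum_le_suminf[OF sums_summable[OF F_sums[of x]], of "{n}"] sums_unique[OF F_sums[of x]] w
          by (simp add: less_imp_le)
        finally show ?thesis .
      qed
      \<comment> \<open>If a tail of G vanished, \<nu> would vanish on all later windows, and
        asymptotic equivalence to an eventually zero function would make the tails of F eventually
        zero.\<close>
      have pos: "0 < D G x" for x
      proof (rule ccontr)
        assume "\<not> 0 < D G x"
        then have "D G y = 0" if "x \<le> y" for y
          using D_antimono_infinite[OF True G that] measure_nonneg[of G "shift_int T x"]
            measure_nonneg[of G "shift_int T y"] by linarith
        then have "measure \<nu> (shift_int T y) = 0" if "max 1 x \<le> y" for y
          using nu_D[of y] that by simp
        then have "\<forall>\<^sub>F y in at_top. measure \<nu> (shift_int T y) = 0"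
          unfolding eventually_at_top_linorder by blast
        with asymp_equiv_eventually_zeros[OF asymp] have "\<forall>\<^sub>F y in at_top. D F y = 0"
          by eventually_elim simp
        from eventually_happens[OF this] show False using F_pos by (auto simp: less_le)
      qed
      then have pos': "\<forall>\<^sub>F x in at_top. 0 < D G x" by simp
      have min: "minorizes G (H n) (real n)" for n
      proof (induction n)
        case (Suc n)
        then show ?case
          using minorizes_convolution_infinite[OF True H G _ Suc] by (simp add: H_def add.commute)
      qed (simp add: minorizes_0)
      \<comment> \<open>Monotone tails let the factor \<open>B\<close> simply be dropped, so the
        bound for H_2 reaches G * G before long-tailedness is known; that bound then yields
        long-tailedness.\<close>
      have "D (G \<star> G) x \<le> D (H 2) x" for x
      proof -
        have BG: "pos_law (B \<star> G)" by (rule pos_law_convolution[OF B G])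
        have "slab G G UNIV x \<le> 1 * slab (B \<star> G) G UNIV x"
          by (rule slab_mono[OF G BG G]) (auto intro: D_le_convolution_infinite[OF True B G])
        then show ?thesis
          by (simp add: slab_UNIV G BG H_def numeral_2_eq_2)
      qed
      then have GG: "majorizes G (G \<star> G) 2"
        using H2[OF pos' min] by (auto simp: majorizes_def elim!: all_forward imp_forward eventually_mono intro: order_trans)
      with L_Delta_infinite[OF True G pos] show ?thesis by (intro concl) auto
    qed
  qed
qed

end
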